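(* Let $p$ be a prime and let $G$ be a finite $p$-group. (i) If $G$ has coclass $2$ and $|G|\ge p^5$, then $p^2\in\mathrm{cod}(G)$. (ii) If $G$ has coclass $3$ and $|G|\ge p^6$, then $p^2\in\mathrm{cod}(G)$.
   Context: Characters are complex characters. For an irreducible character $\chi$ of a finite group $G$, the codegree of $\chi$ is $\mathrm{cod}(\chi)=|G:\ker(\chi)|/\chi(1)$, and $\mathrm{cod}(G)=\{\mathrm{cod}(\chi):\chi\in\mathrm{Irr}(G)\}$, where $\mathrm{Irr}(G)$ is the set of irreducible characters of $G$. The coclass of a finite $p$-group $G$ of nilpotence class $c$ is $\log_p(|G|)-c$. *)

theory Defs
  imports
    Complex_Main
    "HOL-Computational_Algebra.Primes"
    "HOL-Algebra.Coset"
    "HOL-Algebra.Generated_Groups"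
    "Jordan_Normal_Form.Matrix"
    "Jordan_Normal_Form.VS_Connect"
begin

definition finite_p_group :: "nat \<Rightarrow> ('a, 'b) monoid_scheme \<Rightarrow> bool" where
  "finite_p_group p G \<longleftrightarrow>
     group G \<and> finite (carrier G) \<and> (\<exists>n. Coset.order G = p ^ n)"

definition commutator_subgroup ::
  "('a, 'b) monoid_scheme \<Rightarrow> 'a set \<Rightarrow> 'a set \<Rightarrow> 'a set" where
  "commutator_subgroup G H K =
     generate G (\<Union>h\<in>H. \<Union>k\<in>K. {h \<otimes>\<^bsub>G\<^esub> k \<otimes>\<^bsub>G\<^esub> inv\<^bsub>G\<^esub> h \<otimes>\<^bsub>G\<^esub> inv\<^bsub>G\<^esub> k})"

(* Indexed from 0: lower_central G i is the term usually written gamma_(i+1)(G). *)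
primrec lower_central :: "('a, 'b) monoid_scheme \<Rightarrow> nat \<Rightarrow> 'a set" where
  "lower_central G 0 = carrier G"
| "lower_central G (Suc i) = commutator_subgroup G (lower_central G i) (carrier G)"

(* Meaningful for nilpotent G only, in particular for every finite p-group. *)
definition nilpotency_class :: "('a, 'b) monoid_scheme \<Rightarrow> nat" where
  "nilpotency_class G = (LEAST c. lower_central G c = {\<one>\<^bsub>G\<^esub>})"

(* Real-valued, so that the subtraction is not truncated. *)
definition coclass :: "nat \<Rightarrow> ('a, 'b) monoid_scheme \<Rightarrow> real" where
  "coclass p G = log (real p) (real (Coset.order G)) - real (nilpotency_class G)"

definition complex_rep :: "('a, 'b) monoid_scheme \<Rightarrow> nat \<Rightarrow> ('a \<Rightarrow> complex mat) \<Rightarrow> bool" where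
  "complex_rep G n \<rho> \<longleftrightarrow> \<rho> \<in> hom G (units_of (ring_mat TYPE(complex) n ()))"

definition irreducible_rep ::
  "('a, 'b) monoid_scheme \<Rightarrow> nat \<Rightarrow> ('a \<Rightarrow> complex mat) \<Rightarrow> bool" where
  "irreducible_rep G n \<rho> \<longleftrightarrow>
     complex_rep G n \<rho> \<and> 0 < n \<and>
     (\<forall>W. VectorSpace.subspace class_ring W (module_vec TYPE(complex) n) \<longrightarrow>
          (\<forall>g\<in>carrier G. \<forall>w\<in>W. \<rho> g *\<^sub>v w \<in> W) \<longrightarrow>
          W = {0\<^sub>v n} \<or> W = carrier_vec n)"

definition mat_trace :: "complex mat \<Rightarrow> complex" where
  "mat_trace A = (\<Sum>i<dim_row A. A $$ (i, i))"

(* Characters are made undefined outside the carrier, so that equal characters are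
   equal as HOL functions. *)
definition character_of ::
  "('a, 'b) monoid_scheme \<Rightarrow> ('a \<Rightarrow> complex mat) \<Rightarrow> 'a \<Rightarrow> complex" where
  "character_of G \<rho> = restrict (\<lambda>g. mat_trace (\<rho> g)) (carrier G)"

definition Irr :: "('a, 'b) monoid_scheme \<Rightarrow> ('a \<Rightarrow> complex) set" where
  "Irr G = {character_of G \<rho> |n \<rho>. irreducible_rep G n \<rho>}"

definition char_kernel :: "('a, 'b) monoid_scheme \<Rightarrow> ('a \<Rightarrow> complex) \<Rightarrow> 'a set" where
  "char_kernel G \<chi> = {g \<in> carrier G. \<chi> g = \<chi> \<one>\<^bsub>G\<^esub>}"

(* Complex-valued because the degree \<chi> 1 is; the division is exact. *)
definition codegree :: "('a, 'b) monoid_scheme \<Rightarrow> ('a \<Rightarrow> complex) \<Rightarrow> complex" where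
  "codegree G \<chi> = of_nat (card (rcosets\<^bsub>G\<^esub> (char_kernel G \<chi>))) / \<chi> \<one>\<^bsub>G\<^esub>"

definition cod :: "('a, 'b) monoid_scheme \<Rightarrow> complex set" where
  "cod G = codegree G ` Irr G"

end

theory Submission
  imports Defs "HOL-Algebra.Group_Action" "HOL-Algebra.Multiplicative_Group"
begin

text \<open>
  Codegrees of a quotient are codegrees of the group, since an irreducible character of a quotient
  inflates to one with the same degree and the same index of the kernel. So \<open>p\<^sup>2\<close> is a codegree of
  a finite p-group \<open>G\<close> as soon as one of two quotients exists. If some \<open>x\<^sup>p\<close> lies outside \<open>G'\<close>, then
  \<open>G/G'\<close> has a linear character whose values form a cyclic group of order \<open>p\<^sup>2\<close>
  (\<open>prime_square_in_cod_if_derived_quotient_not_elementary\<close>). If \<open>G/M\<close> is nonabelian of order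
  \<open>p\<^sup>3\<close>, then it has a faithful irreducible character of degree \<open>p\<close>, of codegree \<open>p\<^sup>3 / p\<close>
  (\<open>prime_square_in_cod_if_nonabelian_quotient\<close>).

  Coclass 2 and coclass 3 are handled together. Let \<open>|G| = p^(c+k)\<close> with \<open>k \<le> 3\<close> and class \<open>c \<ge> 3\<close>,
  and write \<open>\<gamma>\<^sub>i\<close> for the lower central series. Every factor of that series is nontrivial, hence
  \<open>|\<gamma>\<^sub>4| \<ge> p^(c-3)\<close> and \<open>|G : \<gamma>\<^sub>4| \<le> p\<^sup>6\<close>. Factoring out a subgroup of index \<open>p\<close> in \<open>\<gamma>\<^sub>3\<close> that
  contains \<open>\<gamma>\<^sub>4\<close>, one may assume that \<open>|G| \<le> p\<^sup>6\<close> and that \<open>T = \<gamma>\<^sub>3\<close> is central of order \<open>p\<close>, while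
  \<open>D = G'\<close> is not central. By the first source one may also assume that every \<open>x\<^sup>p\<close> lies in \<open>D\<close>.

  A nonabelian quotient of order \<open>p\<^sup>3\<close> now comes from a subgroup \<open>N\<close> with \<open>T \<le> N < D\<close>, of index \<open>p\<close>
  in \<open>D\<close>, together with enough elements \<open>x\<close> such that \<open>[x,G] \<subseteq> N\<close> and \<open>x\<^sup>p \<in> N\<close>: modulo \<open>N\<close> such
  elements span an elementary abelian central subgroup, and a complement in it to \<open>D/N\<close> can be
  factored out. The commutator form and the power map are related by class three: if \<open>x\<close>
  centralizes \<open>D\<close>, and \<open>y\<close> commutes with \<open>[x,y]\<close>, then \<open>[x\<^sup>p,y] = [x,y]\<^sup>p = [x,y\<^sup>p] = 1\<close>. Moreover
  the centralizer \<open>C\<close> of \<open>D\<close> satisfies \<open>[C,C] \<subseteq> D \<inter> Z(G)\<close>.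

  If \<open>D \<inter> Z(G)\<close> has index \<open>p\<close> in \<open>D\<close>, take \<open>N = D \<inter> Z(G)\<close>
  (\<open>prime_square_in_cod_if_center_index_p\<close>). Otherwise the bound \<open>|G| \<le> p\<^sup>6\<close> leaves one
  configuration: \<open>|G : D| = |D| = p\<^sup>3\<close>, \<open>D \<inter> Z(G) = T\<close>, and \<open>G\<close> is generated modulo \<open>D\<close> by
  \<open>h\<^sub>1\<close>, \<open>h\<^sub>2\<close> and an element \<open>e\<close> of \<open>C\<close>. The map \<open>g \<mapsto> [e,g]\<close> from \<open>G/C\<close> to \<open>D/T\<close> is a linear map
  between planes over the field with \<open>p\<close> elements. If it is singular, then \<open>x = e\<close> works for an
  \<open>N\<close> that contains its image. If it is bijective, then \<open>h\<^sub>1\<close> and \<open>h\<^sub>2\<close> can be changed by powers of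
  \<open>e\<close> so as to commute modulo \<open>T\<close>, which forces \<open>h\<^sub>1\<^sup>p \<in> T\<close>, and \<open>x = h\<^sub>1\<close> works.
\<close>

section \<open>Commutators and centralizers modulo a normal subgroup\<close>

context group
begin

definition comm :: "'a \<Rightarrow> 'a \<Rightarrow> 'a" where
  "comm x y = x \<otimes> y \<otimes> inv x \<otimes> inv y"

text \<open>For normal \<open>N\<close> this is the preimage of the centralizer of the image of \<open>S\<close> in \<open>G/N\<close>; with
  \<open>N = {\<one>}\<close> it is the centralizer of \<open>S\<close>, and with \<open>S = carrier G\<close> the preimage of the centre of
  \<open>G/N\<close>.\<close>
definition cent_mod :: "'a set \<Rightarrow> 'a set \<Rightarrow> 'a set" where
  "cent_mod N S = {g \<in> carrier G. \<forall>s\<in>S. comm g s \<in> N}"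

text \<open>Together with the rules for inverses these complete the rewrite system of the free group, so
  that \<open>word_simps\<close> decides identities between words.\<close>
lemma mult_inv_cancel:
  "\<lbrakk>x \<in> carrier G; y \<in> carrier G\<rbrakk> \<Longrightarrow> x \<otimes> (inv x \<otimes> y) = y"
  "\<lbrakk>x \<in> carrier G; y \<in> carrier G\<rbrakk> \<Longrightarrow> inv x \<otimes> (x \<otimes> y) = y"
  by (simp_all flip: m_assoc)

lemmas word_simps = m_assoc inv_mult_group mult_inv_cancel

lemma comm_closed [simp]: "\<lbrakk>x \<in> carrier G; y \<in> carrier G\<rbrakk> \<Longrightarrow> comm x y \<in> carrier G"
  by (simp add: comm_def)

lemma comm_inv: "\<lbrakk>x \<in> carrier G; y \<in> carrier G\<rbrakk> \<Longrightarrow> inv (comm x y) = comm y x"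
  by (simp add: comm_def word_simps)

lemma comm_self [simp]: "x \<in> carrier G \<Longrightarrow> comm x x = \<one>"
  by (simp add: comm_def word_simps)

lemma comm_eq_one_iff:
  assumes "x \<in> carrier G" "y \<in> carrier G"
  shows "comm x y = \<one> \<longleftrightarrow> x \<otimes> y = y \<otimes> x"
proof
  assume "comm x y = \<one>"
  then have "comm x y \<otimes> (y \<otimes> x) = y \<otimes> x" using assms by simp
  then show "x \<otimes> y = y \<otimes> x" using assms by (simp add: comm_def word_simps)
next
  assume "x \<otimes> y = y \<otimes> x"
  then show "comm x y = \<one>" using assms unfolding comm_def by (simp add: word_simps)
qed

lemma comm_mult_left:
  "\<lbrakk>x \<in> carrier G; y \<in> carrier G; z \<in> carrier G\<rbrakk>
   \<Longrightarrow> comm (x \<otimes> y) z = x \<otimes> comm y z \<otimes> inv x \<otimes> comm x z"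
  by (simp add: comm_def word_simps)

lemma conj_eq_comm_mult:
  "\<lbrakk>x \<in> carrier G; y \<in> carrier G\<rbrakk> \<Longrightarrow> x \<otimes> y \<otimes> inv x = comm x y \<otimes> y"
  by (simp add: comm_def word_simps)

lemma comm_commute:
  assumes "subgroup N G" "x \<in> carrier G" "y \<in> carrier G" "comm x y \<in> N"
  shows "comm y x \<in> N"
  using subgroup.m_inv_closed[OF assms(1,4)] assms by (simp add: comm_inv)

lemma commute_inv:
  assumes "a \<in> carrier G" "b \<in> carrier G" "a \<otimes> b = b \<otimes> a"
  shows "a \<otimes> inv b = inv b \<otimes> a"
proof -
  have "inv b \<otimes> (a \<otimes> b) \<otimes> inv b = inv b \<otimes> (b \<otimes> a) \<otimes> inv b" using assms by simp
  then show ?thesis using assms(1,2) by (simp add: word_simps)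
qed

lemma comm_pow_left:
  assumes "x \<in> carrier G" "g \<in> carrier G" "x \<otimes> comm x g = comm x g \<otimes> x"
  shows "comm (x [^] (n::nat)) g = comm x g [^] n"
proof (induction n)
  case 0
  then show ?case using assms by (simp add: comm_def)
next
  case (Suc n)
  have "x [^] n \<otimes> comm x g = comm x g \<otimes> x [^] n"
    using assms by (metis comm_closed group_commutes_pow)
  then have "x [^] n \<otimes> comm x g \<otimes> inv (x [^] n) = comm x g"
    using assms by (simp add: word_simps)
  then show ?case
    using assms Suc nat_pow_Suc2[of "comm x g" n] by (simp add: comm_mult_left)
qed

lemma comm_pow_right:
  assumes "x \<in> carrier G" "g \<in> carrier G" "g \<otimes> comm x g = comm x g \<otimes> g"
  shows "comm x (g [^] (n::nat)) = comm x g [^] n"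
proof -
  have "g \<otimes> comm g x = comm g x \<otimes> g"
    using commute_inv[OF assms(2) comm_closed[OF assms(1,2)] assms(3)] assms by (simp add: comm_inv)
  from comm_pow_left[OF assms(2,1) this, of n]
  have "inv (comm (g [^] n) x) = (inv (comm g x)) [^] n" using assms(1,2) by (simp add: nat_pow_inv)
  then show ?thesis using assms(1,2) by (simp only: comm_inv nat_pow_closed)
qed

text \<open>That these sets are subgroups is the means by which a statement about commutators is checked on
  generators only.\<close>
lemma subgroup_cent_mod:
  assumes "N \<lhd> G" "S \<subseteq> carrier G"
  shows "subgroup (cent_mod N S) G"
proof -
  interpret N: normal N G by fact
  show ?thesis
  proof (rule subgroupI)
    show "cent_mod N S \<subseteq> carrier G" by (auto simp: cent_mod_def)
    have "\<one> \<in> cent_mod N S" using assms(2) by (auto simp: cent_mod_def comm_def subset_iff)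
    then show "cent_mod N S \<noteq> {}" by auto
  next
    fix a assume a: "a \<in> cent_mod N S"
    then have ac: "a \<in> carrier G" by (simp add: cent_mod_def)
    show "inv a \<in> cent_mod N S" unfolding cent_mod_def
    proof (intro CollectI conjI ballI)
      show "inv a \<in> carrier G" using ac by simp
      fix s assume s: "s \<in> S"
      then have sc: "s \<in> carrier G" using assms by auto
      have "comm (inv a) s = inv a \<otimes> inv (comm a s) \<otimes> a"
        using ac sc by (simp add: comm_def word_simps)
      moreover have "comm a s \<in> N" using a s by (simp add: cent_mod_def)
      ultimately show "comm (inv a) s \<in> N"
        using N.inv_op_closed1[OF ac] by simp
    qed
  next
    fix a b assume a: "a \<in> cent_mod N S" and b: "b \<in> cent_mod N S"
    then have ac: "a \<in> carrier G" "b \<in> carrier G" by (auto simp add: cent_mod_def)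
    show "a \<otimes> b \<in> cent_mod N S" unfolding cent_mod_def
    proof (intro CollectI conjI ballI)
      show "a \<otimes> b \<in> carrier G" using ac by simp
      fix s assume s: "s \<in> S"
      then have sc: "s \<in> carrier G" using assms by auto
      have "comm a s \<in> N" "comm b s \<in> N" using a b s by (simp_all add: cent_mod_def)
      then show "comm (a \<otimes> b) s \<in> N"
        using N.inv_op_closed2[OF ac(1)] by (simp add: comm_mult_left ac sc)
    qed
  qed
qed

lemma subgroup_pow_closed:
  assumes "subgroup N G" "x \<in> N"
  shows "x [^] (n::nat) \<in> N"
proof (induction n)
  case 0
  show ?case using subgroup.one_closed[OF assms(1)] by simp
next
  case (Suc n)
  then show ?case using subgroup.m_closed[OF assms(1) Suc assms(2)] by simp
qed

lemma normal_if_comm_closed: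
  assumes "subgroup M G" "\<And>m g. \<lbrakk>m \<in> M; g \<in> carrier G\<rbrakk> \<Longrightarrow> comm m g \<in> M"
  shows "M \<lhd> G"
proof (rule normal_invI[OF assms(1)])
  fix g m assume g: "g \<in> carrier G" and m: "m \<in> M"
  have mc: "m \<in> carrier G" using subgroup.mem_carrier[OF assms(1) m] .
  have "comm g m \<in> M" using comm_commute[OF assms(1) mc g assms(2)[OF m g]] .
  then show "g \<otimes> m \<otimes> inv g \<in> M"
    using subgroup.m_closed[OF assms(1) _ m, of "comm g m"] by (simp add: conj_eq_comm_mult[OF g mc])
qed

text \<open>The normal form \<open>x\<^sup>i n\<close> with \<open>i < p\<close>, which bounds the order of a cyclic extension of \<open>N\<close>.\<close>
lemma generate_insert_normal:
  assumes N: "N \<lhd> G" and x: "x \<in> carrier G" and xp: "x [^] (p::nat) \<in> N" and p: "p > 0"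
    and y: "y \<in> generate G (insert x N)"
  shows "\<exists>i<p. \<exists>n\<in>N. y = x [^] i \<otimes> n"
proof -
  interpret N: normal N G by fact
  have "\<exists>i::nat. \<exists>n\<in>N. y = x [^] i \<otimes> n"
    using y
  proof (induction rule: generate.induct)
    case one
    then show ?case by (intro exI[of _ 0] bexI[of _ "\<one>"]) auto
  next
    case (incl h)
    show ?case
    proof (cases "h = x")
      case True
      then show ?thesis using x by (intro exI[of _ 1] bexI[of _ "\<one>"]) auto
    next
      case False
      then show ?thesis using incl by (intro exI[of _ 0] bexI[of _ h]) auto
    qed
  next
    case (inv h)
    show ?case
    proof (cases "h = x")
      case True
      have "x [^] p = x \<otimes> x [^] (p - 1)" using p nat_pow_Suc2[OF x, of "p - 1"] by simp
      then have "x \<otimes> (x [^] (p - 1) \<otimes> inv (x [^] p)) = \<one>" using x by (simp flip: m_assoc)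
      then have "inv x = inv x \<otimes> (x \<otimes> (x [^] (p - 1) \<otimes> inv (x [^] p)))" using x by simp
      then have "inv x = x [^] (p-1) \<otimes> inv (x [^] p)"
        using x by (simp add: mult_inv_cancel)
      then show ?thesis using True xp by blast
    next
      case False
      then show ?thesis using inv by (intro exI[of _ 0] bexI[of _ "inv h"]) auto
    qed
  next
    case (eng h1 h2)
    then obtain i n j m where *: "h1 = x [^] (i::nat) \<otimes> n" "h2 = x [^] (j::nat) \<otimes> m" "n \<in> N" "m \<in> N"
      by blast
    have "h1 \<otimes> h2 = x [^] (i+j) \<otimes> ((inv (x [^] j) \<otimes> n \<otimes> x [^] j) \<otimes> m)"
      using * x by (simp add: word_simps flip: nat_pow_mult)
    moreover have "(inv (x [^] j) \<otimes> n \<otimes> x [^] j) \<otimes> m \<in> N"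
      using * x N.inv_op_closed1 by simp
    ultimately show ?case by blast
  qed
  then obtain i n where *: "y = x [^] (i::nat) \<otimes> n" "n \<in> N" by blast
  have "x [^] i = x [^] (i mod p) \<otimes> (x [^] p) [^] (i div p)"
    using x by (simp add: nat_pow_pow nat_pow_mult)
  then have "y = x [^] (i mod p) \<otimes> ((x [^] p) [^] (i div p) \<otimes> n)"
    using * x by (simp add: m_assoc)
  moreover have "(x [^] p) [^] (i div p) \<otimes> n \<in> N"
    using xp * by (simp add: subgroup_pow_closed[OF N.subgroup_axioms])
  ultimately show ?thesis using p mod_less_divisor by blast
qed

text \<open>A map that separates the left cosets of \<open>L\<close> bounds the index of \<open>L\<close>.\<close>
lemma card_le_fibre:
  assumes "finite (carrier G)" "K \<subseteq> carrier G" "L \<subseteq> carrier G" "f ` K \<subseteq> S" "finite S"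
    and "\<And>a b. \<lbrakk>a \<in> K; b \<in> K; f a = f b\<rbrakk> \<Longrightarrow> inv a \<otimes> b \<in> L"
  shows "card K \<le> card S * card L"
proof -
  have finK: "finite K" using assms finite_subset by blast
  have "K = (\<Union>s\<in>S. {a\<in>K. f a = s})" using assms by auto
  then have "card K \<le> (\<Sum>s\<in>S. card {a\<in>K. f a = s})"
    using card_UN_le[OF assms(5), of "\<lambda>s. {a\<in>K. f a = s}"] by simp
  also have "\<dots> \<le> (\<Sum>s\<in>S. card L)"
  proof (rule sum_mono)
    fix s assume "s \<in> S"
    show "card {a\<in>K. f a = s} \<le> card L"
    proof (cases "{a\<in>K. f a = s} = {}")
      case False
      then obtain a where a: "a \<in> K" "f a = s" by auto
      have "inj_on (\<lambda>b. inv a \<otimes> b) {a\<in>K. f a = s}"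
        using assms(2) a by (auto intro!: inj_onI simp: subset_iff)
      moreover have "(\<lambda>b. inv a \<otimes> b) ` {a\<in>K. f a = s} \<subseteq> L" using a assms(6) by auto
      moreover have "finite L" using assms finite_subset by blast
      ultimately show ?thesis by (rule card_inj_on_le)
    next
      case True
      then show ?thesis by (simp only: True) simp
    qed
  qed
  finally show ?thesis by simp
qed

lemma comm_eq_one_sym: "\<lbrakk>x \<in> carrier G; y \<in> carrier G\<rbrakk> \<Longrightarrow> comm x y = \<one> \<longleftrightarrow> comm y x = \<one>"
  by (auto simp: comm_eq_one_iff)

lemma comm_in_derived: "\<lbrakk>x \<in> carrier G; y \<in> carrier G\<rbrakk> \<Longrightarrow> comm x y \<in> derived G (carrier G)"
  unfolding derived_def comm_def by (rule generate.incl) blast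

lemma derived_least:
  assumes "subgroup S G" "\<And>x y. \<lbrakk>x \<in> carrier G; y \<in> carrier G\<rbrakk> \<Longrightarrow> comm x y \<in> S"
  shows "derived G (carrier G) \<subseteq> S"
  unfolding derived_def using assms(2) by (intro generate_subgroup_incl[OF _ assms(1)]) (auto simp: comm_def)

lemma subgroup_comm_closed: "\<lbrakk>subgroup S G; x \<in> S; y \<in> S\<rbrakk> \<Longrightarrow> comm x y \<in> S"
  unfolding comm_def by (intro subgroup.m_closed subgroup.m_inv_closed)

lemma subgroup_centralizer: "S \<subseteq> carrier G \<Longrightarrow> subgroup (cent_mod {\<one>} S) G"
  by (rule subgroup_cent_mod[OF one_is_normal])

lemma in_centralizer_iff:
  "s \<in> carrier G \<Longrightarrow> g \<in> cent_mod {\<one>} {s} \<longleftrightarrow> g \<in> carrier G \<and> comm g s = \<one>"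
  by (simp add: cent_mod_def)

text \<open>Conjugation by \<open>z\<close> multiplies \<open>x\<close> and \<open>y\<close> by \<open>u = [z,x]\<close> and \<open>v = [z,y]\<close>; if these commute with
  \<open>x\<close>, \<open>y\<close> and each other, they cancel from \<open>[u x, v y]\<close>, so \<open>z\<close> fixes \<open>[x,y]\<close>. This does
  the work of the Hall-Witt identity below.\<close>
lemma comm_comm_trivial:
  assumes c: "x \<in> carrier G" "y \<in> carrier G" "z \<in> carrier G"
    and uv: "comm (comm z x) x = \<one>" "comm (comm z x) y = \<one>"
      "comm (comm z y) x = \<one>" "comm (comm z y) y = \<one>" "comm (comm z x) (comm z y) = \<one>"
  shows "comm z (comm x y) = \<one>"
proof -
  define u v where "u = comm z x" and "v = comm z y"
  have uvc: "u \<in> carrier G" "v \<in> carrier G" using c by (simp_all add: u_def v_def)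
  have comms: "comm x v = \<one>" "comm y v = \<one>" "comm y u = \<one>" "comm x u = \<one>" "comm v u = \<one>" "comm u v = \<one>"
    using uv c uvc comm_eq_one_sym by (simp_all add: u_def v_def)
  have cu: "subgroup (cent_mod {\<one>} {u}) G" "subgroup (cent_mod {\<one>} {v}) G"
    using uvc by (simp_all add: subgroup_centralizer)
  have xyv: "comm x y \<otimes> v = v \<otimes> comm x y"
  proof -
    have "comm x y \<in> cent_mod {\<one>} {v}"
      by (rule subgroup_comm_closed[OF cu(2)]) (use c uvc comms in \<open>simp_all add: in_centralizer_iff\<close>)
    then show ?thesis using c uvc comm_eq_one_iff by (simp add: in_centralizer_iff)
  qed
  have xyu: "comm x y \<otimes> u = u \<otimes> comm x y"
  proof -
    have "comm x y \<in> cent_mod {\<one>} {u}"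
      by (rule subgroup_comm_closed[OF cu(1)]) (use c uvc comms in \<open>simp_all add: in_centralizer_iff\<close>)
    then show ?thesis using c uvc comm_eq_one_iff by (simp add: in_centralizer_iff)
  qed
  have vy_u: "comm u (v \<otimes> y) = \<one>"
  proof -
    have "v \<otimes> y \<in> cent_mod {\<one>} {u}"
      by (rule subgroup.m_closed[OF cu(1)]) (use c uvc comms in \<open>simp_all add: in_centralizer_iff\<close>)
    then show ?thesis using c uvc comm_eq_one_sym[of u "v \<otimes> y"] by (simp add: in_centralizer_iff)
  qed
  have yx: "v \<otimes> comm y x \<otimes> inv v = comm y x"
  proof -
    have "comm y x \<in> cent_mod {\<one>} {v}"
      by (rule subgroup_comm_closed[OF cu(2)]) (use c uvc comms in \<open>simp_all add: in_centralizer_iff\<close>)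
    then have "comm y x \<otimes> v = v \<otimes> comm y x" using c uvc comm_eq_one_iff by (simp add: in_centralizer_iff)
    then have "v \<otimes> comm y x \<otimes> inv v = comm y x \<otimes> v \<otimes> inv v" by simp
    then show ?thesis using c uvc by (simp add: m_assoc)
  qed
  have vx1: "comm v x = \<one>" using comms(1) c uvc comm_eq_one_sym by simp
  have "comm (v \<otimes> y) x = comm y x" using c uvc yx vx1 by (simp add: comm_mult_left)
  then have 1: "comm x (v \<otimes> y) = comm x y" using c uvc comm_inv[of "v \<otimes> y" x] comm_inv[of y x] by simp
  have "z \<otimes> comm x y \<otimes> inv z = comm (z \<otimes> x \<otimes> inv z) (z \<otimes> y \<otimes> inv z)"
    using c by (simp add: comm_def word_simps)
  also have "\<dots> = comm (u \<otimes> x) (v \<otimes> y)" using c by (simp add: conj_eq_comm_mult u_def v_def)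
  also have "\<dots> = u \<otimes> comm x (v \<otimes> y) \<otimes> inv u \<otimes> comm u (v \<otimes> y)" using c uvc by (simp add: comm_mult_left)
  also have "\<dots> = u \<otimes> comm x y \<otimes> inv u" using c uvc vy_u 1 by simp
  also have "\<dots> = comm x y \<otimes> u \<otimes> inv u" using xyu by simp
  also have "\<dots> = comm x y" using c uvc by (simp add: m_assoc)
  finally have "comm z (comm x y) \<otimes> comm x y = comm x y" using c by (simp add: conj_eq_comm_mult)
  then show ?thesis using c by simp
qed

lemma card_image_mod:
  assumes N: "subgroup N G" and X: "subgroup X G" "N \<subseteq> X"
  shows "card ((\<lambda>x. N #> x) ` X) * card N = card X"
proof -
  have "rcosets\<^bsub>G\<lparr>carrier := X\<rparr>\<^esub> N = (\<lambda>x. N #> x) ` X" by (auto simp: RCOSETS_def)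
  then show ?thesis
    using group.lagrange[OF subgroup.subgroup_is_group[OF X(1) is_group] subgroup_incl[OF N X]]
    by (simp add: Coset.order_def)
qed

text \<open>The map \<open>k \<mapsto> N [k,s]\<close> takes at most \<open>m\<close> values and is injective on the left cosets of the
  centralizer of \<open>s\<close> modulo \<open>N\<close>.\<close>
lemma card_cent_mod_le:
  assumes fin: "finite (carrier G)" and N: "N \<lhd> G" and K: "subgroup K G" and s: "s \<in> carrier G"
    and X: "subgroup X G" "N \<subseteq> X" "card X \<le> m * card N"
    and comm_X: "\<And>k. k \<in> K \<Longrightarrow> comm k s \<in> X"
  shows "card K \<le> m * card (K \<inter> cent_mod N {s})"
proof -
  interpret N: normal N G by fact
  have Ns: "subgroup N G" by (rule N.subgroup_axioms)
  let ?S = "(\<lambda>x. N #> x) ` X"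
  have finX: "finite X" using fin subgroup.subset[OF X(1)] finite_subset by blast
  have "card K \<le> card ?S * card (K \<inter> cent_mod N {s})"
  proof (rule card_le_fibre[OF fin])
    show "K \<subseteq> carrier G" using subgroup.subset[OF K] .
    then show "K \<inter> cent_mod N {s} \<subseteq> carrier G" by blast
    show "(\<lambda>k. N #> comm k s) ` K \<subseteq> ?S" using comm_X by auto
    show "finite ?S" using finX by simp
    fix a b assume a: "a \<in> K" and b: "b \<in> K" and eq: "N #> comm a s = N #> comm b s"
    have ac: "a \<in> carrier G" "b \<in> carrier G" using subgroup.mem_carrier[OF K] a b by auto
    have "comm b s \<in> N #> comm a s" using eq rcos_self[OF _ Ns, of "comm b s"] ac s by simp
    then have "comm b s \<otimes> inv (comm a s) \<in> N"
      using N.rcos_module_imp[OF is_group, of "comm a s" "comm b s"] ac s by simp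
    then have "inv a \<otimes> (comm b s \<otimes> inv (comm a s)) \<otimes> a \<in> N" using N.inv_op_closed1[OF ac(1)] by simp
    moreover have "inv a \<otimes> (comm b s \<otimes> inv (comm a s)) \<otimes> a = comm (inv a \<otimes> b) s"
      using ac s by (simp add: comm_def word_simps)
    ultimately have "comm (inv a \<otimes> b) s \<in> N" by simp
    moreover have "inv a \<otimes> b \<in> K" using a b subgroup.m_closed[OF K subgroup.m_inv_closed[OF K a] b] by simp
    ultimately show "inv a \<otimes> b \<in> K \<inter> cent_mod N {s}" using ac by (simp add: cent_mod_def)
  qed
  moreover have "card ?S * card N = card X" by (rule card_image_mod[OF Ns X(1,2)])
  then have "card ?S * card N \<le> m * card N" using X(3) by simp
  moreover have "card N > 0"
    using N.one_closed finite_subset[OF N.subset fin] card_gt_0_iff by blast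
  ultimately have "card ?S \<le> m" by simp
  then show ?thesis using \<open>card K \<le> _\<close> by (meson le_trans mult_le_mono1)
qed

end

section \<open>Finite p-groups\<close>

locale p_group = group G for G (structure) +
  fixes p :: nat
  assumes prime_p: "prime p" and fin: "finite (carrier G)" and ord: "\<exists>n. Coset.order G = p ^ n"
begin

lemma p_pos [simp]: "p > 0" using prime_p prime_gt_0_nat by blast

lemma finite_subgroup: "subgroup K G \<Longrightarrow> finite K"
  using fin subgroup.subset finite_subset by blast

lemma subgroup_card: "subgroup K G \<Longrightarrow> \<exists>n. card K = p ^ n"
  using lagrange[of K] ord divides_primepow_nat[OF prime_p]
  by (metis dvd_triv_right)

text \<open>Orders of subgroups are powers of \<open>p\<close>, so a proper inclusion costs at least a factor \<open>p\<close>. All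
  order computations below are made of such inequalities.\<close>
lemma subgroup_index:
  assumes "subgroup K G" "subgroup L G" "K \<subset> L"
  shows "p * card K \<le> card L"
proof -
  obtain a b where ab: "card K = p ^ a" "card L = p ^ b" using subgroup_card assms by metis
  have "card K < card L" using assms finite_subgroup psubset_card_mono by blast
  then have "a < b" using ab prime_gt_1_nat[OF prime_p] by simp
  then have "p ^ Suc a \<le> p ^ b" using prime_gt_1_nat[OF prime_p] by (intro power_increasing) auto
  then show ?thesis using ab by simp
qed

lemma subgroup_eqI:
  assumes "subgroup K G" "subgroup L G" "K \<subseteq> L" "card L < p * card K"
  shows "K = L"
  using subgroup_index[OF assms(1,2)] assms(3,4) by fastforce

lemma card_generate_le:
  assumes "N \<lhd> G" "x \<in> carrier G" "x [^] p \<in> N"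
  shows "card (generate G (insert x N)) \<le> p * card N"
proof -
  have fN: "finite N" using assms(1) finite_subgroup normal_imp_subgroup by blast
  have "generate G (insert x N) \<subseteq> (\<lambda>(i,n). x [^] i \<otimes> n) ` ({..<p} \<times> N)"
    using generate_insert_normal[OF assms p_pos] by fastforce
  then have "card (generate G (insert x N)) \<le> card ((\<lambda>(i,n). x [^] i \<otimes> n) ` ({..<p} \<times> N))"
    using fN by (intro card_mono) auto
  also have "\<dots> \<le> card ({..<p} \<times> N)" by (rule card_image_le) (use fN in auto)
  finally show ?thesis by (simp add: card_cartesian_product)
qed

lemma generate_insert:
  assumes "subgroup N G" "x \<in> carrier G"
  shows "subgroup (generate G (insert x N)) G" "N \<subseteq> generate G (insert x N)"
    "x \<in> generate G (insert x N)"
  using assms subgroup.subset[OF assms(1)] generate_is_subgroup[of "insert x N"]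
    generate.incl[of _ "insert x N"] by auto

lemma generate_insert_least:
  assumes "subgroup L G" "x \<in> L" "N \<subseteq> L"
  shows "generate G (insert x N) \<subseteq> L"
  using assms by (intro generate_subgroup_incl) auto

lemma card_generate_ge:
  assumes "subgroup N G" "x \<in> carrier G" "x \<notin> N"
  shows "p * card N \<le> card (generate G (insert x N))"
  using subgroup_index[OF assms(1)] generate_insert[OF assms(1,2)] assms(3) by blast

lemma eq_generate_insert:
  assumes "subgroup N G" "subgroup K G" "x \<in> K" "x \<notin> N" "N \<subseteq> K" "card K \<le> p * card N"
  shows "K = generate G (insert x N)"
proof (rule sym, rule card_subset_eq)
  have xc: "x \<in> carrier G" using subgroup.mem_carrier[OF assms(2,3)] .
  show sub: "generate G (insert x N) \<subseteq> K" using generate_insert_least[OF assms(2,3,5)] .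
  show finK: "finite K" using finite_subgroup[OF assms(2)] .
  show "card (generate G (insert x N)) = card K"
    using card_generate_ge[OF assms(1) xc assms(4)] assms(6) card_mono[OF finK sub] by linarith
qed

end

section \<open>Induced monomial characters\<close>

text \<open>Equality in the triangle inequality: this identifies the kernel of a character from its trace.\<close>
lemma sum_norm_le_one_eq_card:
  fixes f :: "'i \<Rightarrow> complex"
  assumes "finite I" "\<And>i. i \<in> I \<Longrightarrow> norm (f i) \<le> 1" "sum f I = of_nat (card I)" "i \<in> I"
  shows "f i = 1"
proof -
  have "Re (sum f I) = real (card I)" using assms(3) by simp
  then have "(\<Sum>j\<in>I. 1 - Re (f j)) = 0" by (simp add: sum_subtractf)
  moreover have "0 \<le> 1 - Re (f j)" if "j \<in> I" for j
    using complex_Re_le_cmod[of "f j"] assms(2)[OF that] by linarith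
  ultimately have re: "Re (f i) = 1"
    using sum_nonneg_eq_0_iff[OF assms(1), of "\<lambda>j. 1 - Re (f j)"] assms(4) by auto
  have "(norm (f i))\<^sup>2 \<le> 1" using assms(2)[OF assms(4)] by (simp add: power_le_one)
  then have "Im (f i) = 0" using re by (simp add: cmod_power2)
  then show ?thesis using re by (simp add: complex_eq_iff)
qed

text \<open>The representation induced from a linear character \<open>lam\<close> of a normal subgroup \<open>A\<close>, written with
  respect to representatives \<open>r 0, \<dots>, r (n - 1)\<close> of the left cosets of \<open>A\<close>. The last assumption says
  that \<open>A\<close> is the whole stabilizer of \<open>lam\<close>, which is Clifford's criterion for irreducibility.\<close>
locale monomial_rep = normal A G for A and G (structure) +
  fixes lam :: "'a \<Rightarrow> complex" and r :: "nat \<Rightarrow> 'a" and n :: nat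
  assumes fin_G: "finite (carrier G)"
    and lam_mult: "\<And>a b. \<lbrakk>a \<in> A; b \<in> A\<rbrakk> \<Longrightarrow> lam (a \<otimes> b) = lam a * lam b"
    and lam_one: "lam \<one> = 1"
    and r_closed [simp]: "\<And>k. k < n \<Longrightarrow> r k \<in> carrier G"
    and r_ex1: "\<And>g. g \<in> carrier G \<Longrightarrow> \<exists>!k. k < n \<and> inv (r k) \<otimes> g \<in> A"
    and lam_moved: "\<And>g. \<lbrakk>g \<in> carrier G; g \<notin> A\<rbrakk> \<Longrightarrow> \<exists>a\<in>A. lam (g \<otimes> a \<otimes> inv g) \<noteq> lam a"
begin

text \<open>The extension of \<open>lam\<close> by zero, as in the formula for induced characters.\<close>
definition lam0 :: "'a \<Rightarrow> complex" where
  "lam0 g = (if g \<in> A then lam g else 0)"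

definition rep :: "'a \<Rightarrow> complex mat" where
  "rep g = mat n n (\<lambda>(i,j). lam0 (inv (r i) \<otimes> g \<otimes> r j))"

lemma r_unique: "\<lbrakk>i < n; j < n; inv (r i) \<otimes> r j \<in> A\<rbrakk> \<Longrightarrow> i = j"
  using r_ex1[of "r j"] by auto

lemma n_pos: "0 < n"
  using r_ex1[of "\<one>"] by auto

lemma mult_in_A_iff:
  assumes "x \<in> carrier G" "y \<in> A"
  shows "x \<otimes> y \<in> A \<longleftrightarrow> x \<in> A"
proof
  assume "x \<otimes> y \<in> A"
  then have "x \<otimes> y \<otimes> inv y \<in> A" using assms by simp
  then show "x \<in> A" using assms by (simp add: m_assoc)
qed (use assms in simp)

lemma lam0_mult: "\<lbrakk>x \<in> carrier G; y \<in> A\<rbrakk> \<Longrightarrow> lam0 (x \<otimes> y) = lam0 x * lam0 y"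
  by (simp add: lam0_def mult_in_A_iff lam_mult)

lemma rep_mult:
  assumes "g \<in> carrier G" "h \<in> carrier G"
  shows "rep (g \<otimes> h) = rep g * rep h"
proof (rule eq_matI)
  fix i j assume "i < dim_row (rep g * rep h)" "j < dim_col (rep g * rep h)"
  then have ij: "i < n" "j < n" by (simp_all add: rep_def)
  have "h \<otimes> r j \<in> carrier G" using assms ij by simp
  from r_ex1[OF this] obtain k where k: "k < n" "inv (r k) \<otimes> (h \<otimes> r j) \<in> A"
    and uniq: "\<And>l. l < n \<Longrightarrow> inv (r l) \<otimes> (h \<otimes> r j) \<in> A \<Longrightarrow> l = k"
    by blast
  have "(rep g * rep h) $$ (i, j)
      = (\<Sum>l<n. lam0 (inv (r i) \<otimes> g \<otimes> r l) * lam0 (inv (r l) \<otimes> h \<otimes> r j))"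
    using ij by (simp add: rep_def scalar_prod_def atLeast0LessThan)
  also have "\<dots> = (\<Sum>l\<in>{k}. lam0 (inv (r i) \<otimes> g \<otimes> r l) * lam0 (inv (r l) \<otimes> h \<otimes> r j))"
  proof (rule sum.mono_neutral_right)
    show "\<forall>l\<in>{..<n} - {k}. lam0 (inv (r i) \<otimes> g \<otimes> r l) * lam0 (inv (r l) \<otimes> h \<otimes> r j) = 0"
      using uniq assms ij by (auto simp: lam0_def m_assoc)
  qed (use k in auto)
  also have "\<dots> = lam0 ((inv (r i) \<otimes> g \<otimes> r k) \<otimes> (inv (r k) \<otimes> (h \<otimes> r j)))"
    using assms ij k by (subst lam0_mult) (auto simp: m_assoc)
  also have "(inv (r i) \<otimes> g \<otimes> r k) \<otimes> (inv (r k) \<otimes> (h \<otimes> r j)) = inv (r i) \<otimes> (g \<otimes> h) \<otimes> r j"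
    using assms ij k by (simp add: word_simps)
  also have "lam0 \<dots> = rep (g \<otimes> h) $$ (i, j)"
    using ij by (simp add: rep_def)
  finally show "rep (g \<otimes> h) $$ (i, j) = (rep g * rep h) $$ (i, j)" by simp
qed (auto simp: rep_def)

lemma lam0_r: "\<lbrakk>i < n; j < n\<rbrakk> \<Longrightarrow> lam0 (inv (r i) \<otimes> r j) = (if i = j then 1 else 0)"
  using r_unique[of i j] by (auto simp: lam0_def lam_one)

lemma rep_one: "rep \<one> = 1\<^sub>m n"
  by (rule eq_matI) (auto simp: rep_def lam0_r)

lemma complex_rep_rep: "complex_rep G n rep"
  unfolding complex_rep_def
proof (rule homI)
  fix g assume g: "g \<in> carrier G"
  have "rep g * rep (inv g) = 1\<^sub>m n" "rep (inv g) * rep g = 1\<^sub>m n"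
    using g by (simp_all add: rep_one flip: rep_mult)
  moreover have "rep g \<in> carrier_mat n n" "rep (inv g) \<in> carrier_mat n n"
    by (simp_all add: rep_def)
  ultimately show "rep g \<in> carrier (units_of (ring_mat TYPE(complex) n ()))"
    by (auto simp: units_of_carrier Units_def ring_mat_simps)
next
  fix g h assume "g \<in> carrier G" "h \<in> carrier G"
  then show "rep (g \<otimes> h) = rep g \<otimes>\<^bsub>units_of (ring_mat TYPE(complex) n ())\<^esub> rep h"
    by (simp add: rep_mult units_of_mult ring_mat_simps)
qed

lemma conj_in_A: "\<lbrakk>k < n; a \<in> A\<rbrakk> \<Longrightarrow> inv (r k) \<otimes> a \<otimes> r k \<in> A"
  using inv_op_closed1 by simp

lemma rep_diagonal:
  assumes a: "a \<in> A" and w: "w \<in> carrier_vec n" and k: "k < n"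
  shows "(rep a *\<^sub>v w) $ k = lam (inv (r k) \<otimes> a \<otimes> r k) * w $ k"
proof -
  have "(rep a *\<^sub>v w) $ k = (\<Sum>j<n. lam0 (inv (r k) \<otimes> a \<otimes> r j) * w $ j)"
    using w k by (auto simp: rep_def scalar_prod_def atLeast0LessThan)
  also have "\<dots> = (\<Sum>j\<in>{k}. lam0 (inv (r k) \<otimes> a \<otimes> r j) * w $ j)"
  proof (rule sum.mono_neutral_right)
    have "inv (r k) \<otimes> a \<otimes> r j \<notin> A" if j: "j < n" "j \<noteq> k" for j
    proof
      assume "inv (r k) \<otimes> a \<otimes> r j \<in> A"
      then have "inv (inv (r k) \<otimes> a \<otimes> r k) \<otimes> (inv (r k) \<otimes> a \<otimes> r j) \<in> A"
        using conj_in_A[OF k a] by simp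
      moreover have "inv (inv (r k) \<otimes> a \<otimes> r k) \<otimes> (inv (r k) \<otimes> a \<otimes> r j) = inv (r k) \<otimes> r j"
        using a k j by (simp add: word_simps)
      ultimately show False using r_unique[of k j] k j by auto
    qed
    then show "\<forall>j\<in>{..<n} - {k}. lam0 (inv (r k) \<otimes> a \<otimes> r j) * w $ j = 0"
      by (auto simp: lam0_def)
  qed (use k in auto)
  finally show ?thesis using conj_in_A[OF k a] by (simp add: lam0_def)
qed

text \<open>The conjugates of \<open>lam\<close> under different representatives differ, because \<open>A\<close> is its stabilizer.\<close>
lemma conj_separates:
  assumes ij: "i < n" "j < n" "i \<noteq> j"
  obtains a where "a \<in> A" "lam (inv (r i) \<otimes> a \<otimes> r i) \<noteq> lam (inv (r j) \<otimes> a \<otimes> r j)"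
proof -
  let ?g = "inv (r i) \<otimes> r j"
  have "?g \<in> carrier G" "?g \<notin> A" using ij r_unique by auto
  then obtain b where b: "b \<in> A" "lam (?g \<otimes> b \<otimes> inv ?g) \<noteq> lam b" using lam_moved by blast
  let ?a = "r j \<otimes> b \<otimes> inv (r j)"
  have "?a \<in> A" using inv_op_closed2[of "r j" b] b ij by simp
  moreover have "inv (r i) \<otimes> ?a \<otimes> r i = ?g \<otimes> b \<otimes> inv ?g" "inv (r j) \<otimes> ?a \<otimes> r j = b"
    using ij b by (simp_all add: word_simps)
  ultimately show ?thesis using that b by metis
qed

text \<open>\<open>A\<close> acts diagonally through the distinct conjugates of \<open>lam\<close>. A nonzero vector of minimal support
  in an invariant subspace is therefore a multiple of a unit vector: if two coordinates \<open>i\<close>, \<open>k\<close>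
  were nonzero, then for an \<open>a\<close> with different eigenvalues there, subtracting the \<open>i\<close>-th eigenvalue
  from the action of \<open>a\<close> would kill coordinate \<open>i\<close> but not \<open>k\<close>. As \<open>G\<close> permutes the lines of the
  unit vectors transitively, all of them lie in the subspace.\<close>
lemma invariant_subspace_trivial:
  assumes W: "VectorSpace.subspace class_ring W (module_vec TYPE(complex) n)"
    and inv: "\<forall>g\<in>carrier G. \<forall>w\<in>W. rep g *\<^sub>v w \<in> W"
    and nz: "W \<noteq> {0\<^sub>v n}"
  shows "W = carrier_vec n"
proof -
  have sub: "submodule class_ring W (module_vec TYPE(complex) n)"
    using W by (rule VectorSpace.subspace.submod)
  note Wsub = submodule.subset[OF sub, unfolded module_vec_simps]
  note Wadd = submodule.m_closed[OF sub, unfolded module_vec_simps]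
  note Wzero = submodule.zero_closed[OF sub, unfolded module_vec_simps]
  note Wsmult = submodule.smult_closed[OF sub, unfolded module_vec_simps, simplified]
  define supp where "supp w = {i. i < n \<and> w $ i \<noteq> (0::complex)}" for w
  have fin_supp: "finite (supp w)" for w by (simp add: supp_def)
  have supp0: "supp w \<noteq> {}" if "w \<in> W" "w \<noteq> 0\<^sub>v n" for w
    using that Wsub by (auto simp: supp_def vec_eq_iff)
  have "\<exists>w. w \<in> W \<and> w \<noteq> 0\<^sub>v n" using nz Wzero by blast
  then obtain w0 where "w0 \<in> W \<and> w0 \<noteq> 0\<^sub>v n" by blast
  from ex_has_least_nat[of "\<lambda>w. w \<in> W \<and> w \<noteq> 0\<^sub>v n", OF this, of "\<lambda>w. card (supp w)"]
  obtain w where w: "w \<in> W" "w \<noteq> 0\<^sub>v n"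
    and w_min: "\<And>v. v \<in> W \<Longrightarrow> v \<noteq> 0\<^sub>v n \<Longrightarrow> card (supp w) \<le> card (supp v)"
    by blast
  have wc: "w \<in> carrier_vec n" using w Wsub by auto
  obtain k where k: "k \<in> supp w" using supp0 w by blast
  have only_k: "i = k" if i: "i \<in> supp w" for i
  proof (rule ccontr)
    assume ne: "i \<noteq> k"
    have lt: "i < n" "k < n" using i k by (auto simp: supp_def)
    obtain a where a: "a \<in> A" "lam (inv (r i) \<otimes> a \<otimes> r i) \<noteq> lam (inv (r k) \<otimes> a \<otimes> r k)"
      using conj_separates lt ne by blast
    define v where "v = rep a *\<^sub>v w + (- lam (inv (r i) \<otimes> a \<otimes> r i)) \<cdot>\<^sub>v w"
    have "rep a *\<^sub>v w \<in> W" using inv mem_carrier[OF a(1)] w(1) by blast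
    then have vW: "v \<in> W" unfolding v_def using Wadd Wsmult[OF w(1)] by blast
    have v_at: "v $ l = (lam (inv (r l) \<otimes> a \<otimes> r l) - lam (inv (r i) \<otimes> a \<otimes> r i)) * w $ l"
      if "l < n" for l
      using rep_diagonal[OF a(1) wc that] that wc by (simp add: v_def algebra_simps)
    have "v $ k \<noteq> 0" using v_at[of k] lt a k by (simp add: supp_def)
    then have "v \<noteq> 0\<^sub>v n" using lt by auto
    moreover have "supp v \<subset> supp w"
    proof
      show "supp v \<subseteq> supp w" using v_at by (auto simp: supp_def)
      have "i \<notin> supp v" using v_at[of i] lt by (simp add: supp_def)
      then show "supp v \<noteq> supp w" using i by blast
    qed
    ultimately show False
      using w_min[OF vW] psubset_card_mono[OF fin_supp, of "supp v" w] by simp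
  qed
  have kn: "k < n" and wk: "w $ k \<noteq> 0" using k by (auto simp: supp_def)
  have "unit_vec n k = (1 / w $ k) \<cdot>\<^sub>v w"
  proof (rule eq_vecI)
    fix l assume "l < dim_vec ((1 / w $ k) \<cdot>\<^sub>v w)"
    then have l: "l < n" using wc by simp
    show "unit_vec n k $ l = ((1 / w $ k) \<cdot>\<^sub>v w) $ l"
    proof (cases "l = k")
      case True
      then show ?thesis using kn wc wk by simp
    next
      case False
      then have "w $ l = 0" using only_k[of l] l by (force simp: supp_def)
      then show ?thesis using False l kn wc by simp
    qed
  qed (use wc in simp)
  then have ek: "unit_vec n k \<in> W" using Wsmult w by simp
  have ei: "unit_vec n i \<in> W" if i: "i < n" for i
  proof -
    have g: "r i \<otimes> inv (r k) \<in> carrier G" using i kn by simp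
    have "rep (r i \<otimes> inv (r k)) *\<^sub>v unit_vec n k = unit_vec n i"
    proof (rule eq_vecI)
      fix l assume "l < dim_vec (unit_vec n i)"
      then have l: "l < n" by simp
      have "(rep (r i \<otimes> inv (r k)) *\<^sub>v unit_vec n k) $ l = rep (r i \<otimes> inv (r k)) $$ (l, k)"
        using l kn by (simp add: rep_def)
      also have "\<dots> = lam0 (inv (r l) \<otimes> r i)"
        using l kn i by (simp add: rep_def word_simps)
      finally show "(rep (r i \<otimes> inv (r k)) *\<^sub>v unit_vec n k) $ l = unit_vec n i $ l"
        using l i by (simp add: lam0_r)
    qed (simp add: rep_def)
    then show ?thesis using inv g ek by metis
  qed
  have "v \<in> W" if v: "v \<in> carrier_vec n" for v
  proof -
    have "vec n (\<lambda>i. if i < m then v $ i else 0) \<in> W" for m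
    proof (induction m)
      case 0
      have "vec n (\<lambda>i. 0) = (0\<^sub>v n :: complex vec)" by (rule eq_vecI) auto
      then show ?case using Wzero by simp
    next
      case (Suc m)
      show ?case
      proof (cases "m < n")
        case True
        have "vec n (\<lambda>i. if i < Suc m then v $ i else 0)
            = vec n (\<lambda>i. if i < m then v $ i else 0) + (v $ m) \<cdot>\<^sub>v unit_vec n m"
          using True by (intro eq_vecI) (auto simp: less_Suc_eq)
        then show ?thesis using Wadd[OF Suc Wsmult[OF ei[OF True]]] by simp
      next
        case False
        have "vec n (\<lambda>i. if i < Suc m then v $ i else 0) = vec n (\<lambda>i. if i < m then v $ i else 0)"
          using False by (intro eq_vecI) auto
        then show ?thesis using Suc by simp
      qed
    qed
    from this[of n] have "vec n (\<lambda>i. if i < n then v $ i else 0) \<in> W" .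
    moreover have "vec n (\<lambda>i. if i < n then v $ i else 0) = v" using v by (intro eq_vecI) auto
    ultimately show ?thesis by simp
  qed
  then show ?thesis using Wsub by blast
qed

lemma irreducible_rep_rep: "irreducible_rep G n rep"
  unfolding irreducible_rep_def
  using complex_rep_rep n_pos invariant_subspace_trivial by blast

lemma norm_lam:
  assumes "a \<in> A"
  shows "norm (lam a) = 1"
proof -
  have "lam (a [^] (m::nat)) = lam a ^ m" for m
  proof (induction m)
    case (Suc m)
    then show ?case using lam_mult[OF subgroup_pow_closed[OF subgroup_axioms assms] assms, of m] by simp
  qed (simp add: lam_one)
  moreover have "a [^] Coset.order G = \<one>" using assms fin_G by (simp add: pow_order_eq_1)
  ultimately have "lam a ^ Coset.order G = 1" using lam_one by metis
  then have "norm (lam a) ^ Coset.order G = 1" by (metis norm_one norm_power)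
  moreover have "Coset.order G > 0" using fin_G by (simp add: order_gt_0_iff_finite)
  ultimately show ?thesis by (metis norm_ge_zero power_eq_1_iff power_eq_imp_eq_base power_one zero_le_one)
qed

lemma character_rep:
  "g \<in> carrier G \<Longrightarrow> character_of G rep g = (\<Sum>i<n. lam0 (inv (r i) \<otimes> g \<otimes> r i))"
  by (simp add: character_of_def mat_trace_def rep_def)

lemma character_rep_one: "character_of G rep \<one> = of_nat n"
  by (simp add: character_rep lam0_def lam_one)

text \<open>The trace is a sum of \<open>n\<close> terms of norm at most one, so it equals \<open>n\<close> only if every term is one.\<close>
lemma kernel_rep:
  "char_kernel G (character_of G rep) = {a \<in> A. \<forall>g\<in>carrier G. lam (g \<otimes> a \<otimes> inv g) = 1}"
proof (intro equalityI subsetI)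
  fix a assume "a \<in> {a \<in> A. \<forall>g\<in>carrier G. lam (g \<otimes> a \<otimes> inv g) = 1}"
  then have a: "a \<in> A" "\<And>g. g \<in> carrier G \<Longrightarrow> lam (g \<otimes> a \<otimes> inv g) = 1" by auto
  have "lam0 (inv (r i) \<otimes> a \<otimes> r i) = 1" if "i < n" for i
    using a(2)[of "inv (r i)"] conj_in_A[OF that a(1)] that by (simp add: lam0_def)
  then show "a \<in> char_kernel G (character_of G rep)"
    using a by (simp add: char_kernel_def character_rep_one) (simp add: character_rep)
next
  fix g assume "g \<in> char_kernel G (character_of G rep)"
  then have g: "g \<in> carrier G" and "character_of G rep g = of_nat n"
    by (simp_all add: char_kernel_def character_rep_one)
  then have sum: "(\<Sum>i<n. lam0 (inv (r i) \<otimes> g \<otimes> r i)) = of_nat (card {..<n})"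
    by (simp add: character_rep)
  have nrm: "norm (lam0 x) \<le> 1" for x by (simp add: lam0_def norm_lam)
  have one: "lam0 (inv (r i) \<otimes> g \<otimes> r i) = 1" if "i < n" for i
    using sum_norm_le_one_eq_card[OF _ _ sum, of i] nrm that by simp
  have conj: "inv (r i) \<otimes> g \<otimes> r i \<in> A" "lam (inv (r i) \<otimes> g \<otimes> r i) = 1" if "i < n" for i
    using one[OF that] by (simp_all add: lam0_def split: if_splits)
  have "r 0 \<otimes> (inv (r 0) \<otimes> g \<otimes> r 0) \<otimes> inv (r 0) \<in> A"
    using inv_op_closed2[of "r 0"] conj(1) n_pos by simp
  then have gA: "g \<in> A" using g n_pos by (simp add: word_simps)
  moreover have "lam (x \<otimes> g \<otimes> inv x) = 1" if x: "x \<in> carrier G" for x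
  proof -
    obtain k where k: "k < n" "inv (r k) \<otimes> inv x \<in> A" using r_ex1[of "inv x"] x by auto
    let ?a = "inv (r k) \<otimes> inv x" and ?c = "inv (r k) \<otimes> g \<otimes> r k"
    have "x \<otimes> g \<otimes> inv x = inv ?a \<otimes> ?c \<otimes> ?a" using x g k by (simp add: word_simps)
    also have "lam \<dots> = lam (inv ?a) * lam ?a" using k conj by (simp add: lam_mult)
    also have "\<dots> = 1" using k by (simp add: lam_one flip: lam_mult)
    finally show ?thesis .
  qed
  ultimately show "g \<in> {a \<in> A. \<forall>g\<in>carrier G. lam (g \<otimes> a \<otimes> inv g) = 1}" by blast
qed

end

context group
begin

lemma left_transversal:
  assumes A: "subgroup A G" and fin: "finite (carrier G)"
  obtains r where "\<And>k. k < Coset.order G div card A \<Longrightarrow> r k \<in> carrier G"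
    "\<And>g. g \<in> carrier G \<Longrightarrow> \<exists>!k. k < Coset.order G div card A \<and> inv (r k) \<otimes> g \<in> A"
proof -
  interpret A: subgroup A G by fact
  let ?n = "card (rcosets A)"
  have fA: "finite A" using fin A.subset finite_subset by blast
  have "card A > 0" using fA A.one_closed card_gt_0_iff by blast
  moreover have "?n * card A = Coset.order G" using lagrange[OF A] .
  ultimately have n: "?n = Coset.order G div card A" by (metis div_mult_self_is_m)
  have "finite (rcosets A)" using fin by (simp add: RCOSETS_def)
  then obtain h where h: "bij_betw h {0..<?n} (rcosets A)" using ex_bij_betw_nat_finite by blast
  \<comment> \<open>Inverting representatives of the right cosets gives representatives of the left ones.\<close>
  define r where "r k = inv (SOME x. x \<in> h k)" for k
  have in_h: "inv (r k) \<in> h k \<and> inv (r k) \<in> carrier G \<and> r k \<in> carrier G" if "k < ?n" for k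
  proof -
    have hk: "h k \<in> rcosets A" using h that by (auto simp: bij_betw_def)
    then obtain x where x: "x \<in> carrier G" "h k = A #> x" by (auto simp: RCOSETS_def)
    then have "x \<in> h k" using rcos_self[OF x(1) A] by simp
    then have s: "(SOME x. x \<in> h k) \<in> h k" by (rule someI)
    then have "(SOME x. x \<in> h k) \<in> carrier G" using x r_coset_subset_G[OF A.subset x(1)] by auto
    then show ?thesis using s by (simp add: r_def)
  qed
  show ?thesis
  proof (rule that[of r, folded n])
    fix k assume "k < ?n"
    then show "r k \<in> carrier G" using in_h by blast
  next
    fix g assume g: "g \<in> carrier G"
    have iff: "inv (r k) \<otimes> g \<in> A \<longleftrightarrow> h k = A #> inv g" if k: "k < ?n" for k
    proof -
      have "h k \<in> rcosets A" using bij_betwE[OF h] k by simp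
      then obtain x where x: "x \<in> carrier G" "h k = A #> x" by (auto simp: RCOSETS_def)
      have hk: "h k = A #> inv (r k)"
        using repr_independence[of "inv (r k)" A x] in_h[OF k] x A by simp
      have "h k = A #> inv g \<longleftrightarrow> inv (r k) \<in> A #> inv g"
        using hk repr_independence[OF _ _ A, of "inv (r k)" "inv g"] rcos_self[OF _ A, of "inv (r k)"]
          in_h[OF k] g by auto
      also have "\<dots> \<longleftrightarrow> inv (r k) \<otimes> inv (inv g) \<in> A"
        using A.rcos_module[OF is_group, of "inv g" "inv (r k)"] in_h[OF k] g by simp
      finally show ?thesis using g by simp
    qed
    have "A #> inv g \<in> rcosets A" using g by (simp add: rcosetsI A.subset)
    then obtain l where l: "l < ?n" "h l = A #> inv g"
      using bij_betw_imp_surj_on[OF h] by (metis atLeastLessThan_iff imageE)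
    have "\<exists>!k. k < ?n \<and> h k = A #> inv g"
    proof (rule ex1I[of _ l])
      fix k assume "k < ?n \<and> h k = A #> inv g"
      then show "k = l" using inj_onD[OF bij_betw_imp_inj_on[OF h], of k l] l by simp
    qed (use l in simp)
    then show "\<exists>!k. k < ?n \<and> inv (r k) \<otimes> g \<in> A" using iff by metis
  qed
qed

theorem monomial_character:
  assumes A: "A \<lhd> G" and fin: "finite (carrier G)"
    and lam_mult: "\<And>a b. \<lbrakk>a \<in> A; b \<in> A\<rbrakk> \<Longrightarrow> lam (a \<otimes> b) = lam a * lam b"
    and lam_one: "lam \<one> = (1::complex)"
    and lam_moved: "\<And>g. \<lbrakk>g \<in> carrier G; g \<notin> A\<rbrakk> \<Longrightarrow> \<exists>a\<in>A. lam (g \<otimes> a \<otimes> inv g) \<noteq> lam a"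
  obtains \<chi> where "\<chi> \<in> Irr G" "\<chi> \<one> = of_nat (Coset.order G div card A)"
    "char_kernel G \<chi> = {a \<in> A. \<forall>g\<in>carrier G. lam (g \<otimes> a \<otimes> inv g) = 1}"
proof -
  obtain r where "\<And>k. k < Coset.order G div card A \<Longrightarrow> r k \<in> carrier G"
    "\<And>g. g \<in> carrier G \<Longrightarrow> \<exists>!k. k < Coset.order G div card A \<and> inv (r k) \<otimes> g \<in> A"
    using left_transversal[OF normal_imp_subgroup[OF A] fin] by blast
  then interpret M: monomial_rep A G lam r "Coset.order G div card A"
    using assms by (intro monomial_rep.intro monomial_rep_axioms.intro) auto
  show ?thesis
    by (rule that[OF _ M.character_rep_one M.kernel_rep])
      (use M.irreducible_rep_rep in \<open>auto simp: Irr_def\<close>)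
qed

end

section \<open>Linear characters of finite abelian groups\<close>

text \<open>Multiplicativity on the subset \<open>B\<close> only; values outside \<open>B\<close> are arbitrary, which lets the same
  function serve for a group and for its subgroups.\<close>
definition lin_char :: "('a, 'b) monoid_scheme \<Rightarrow> 'a set \<Rightarrow> ('a \<Rightarrow> complex) \<Rightarrow> bool" where
  "lin_char G B lam \<longleftrightarrow> lam \<one>\<^bsub>G\<^esub> = 1 \<and> (\<forall>a\<in>B. \<forall>b\<in>B. lam (a \<otimes>\<^bsub>G\<^esub> b) = lam a * lam b)"

lemma exists_root_of_unity_ne_one:
  assumes "k \<ge> 2"
  obtains w :: complex where "w ^ k = 1" "w \<noteq> 1"
proof -
  have "card {z::complex. z ^ k = 1} = k" using card_roots_unity_eq[of k] assms by simp
  then have "\<not> {z::complex. z ^ k = 1} \<subseteq> {1}"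
    using card_mono[of "{1::complex}" "{z. z ^ k = 1}"] assms by auto
  then show ?thesis using that by blast
qed

lemma exists_root:
  assumes "k > 0"
  obtains w :: complex where "w ^ k = z"
proof (cases "z = 0")
  case True
  then show ?thesis using that[of 0] assms by simp
next
  case False
  then have "card {w. w ^ k = z} = k" using assms by (intro card_nth_roots) auto
  then have "{w. w ^ k = z} \<noteq> {}" using assms by (metis card.empty less_irrefl)
  then show ?thesis using that by blast
qed

lemma (in group) lin_char_pow:
  assumes "lin_char G B lam" "subgroup B G" "b \<in> B"
  shows "lam (b [^] (n::nat)) = lam b ^ n"
proof (induction n)
  case 0
  then show ?case using assms by (simp add: lin_char_def)
next
  case (Suc n)
  have "b [^] n \<in> B" using assms by (simp add: subgroup_pow_closed)
  then have "lam (b [^] n \<otimes> b) = lam (b [^] n) * lam b"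
    using assms by (simp add: lin_char_def)
  then show ?case using Suc by simp
qed

context comm_group
begin

text \<open>The value at \<open>a\<close> may be any \<open>k\<close>-th root of the value prescribed at \<open>a\<^sup>k\<close>, where \<open>k\<close> is the order of
  \<open>a\<close> modulo \<open>B\<close>: two expressions \<open>a\<^sup>i b = a\<^sup>j c\<close> differ by a power of \<open>a\<close> that lies in \<open>B\<close>, hence by
  a power of \<open>a\<^sup>k\<close>.\<close>
lemma lin_char_extend_step:
  assumes B: "subgroup B G" and lam: "lin_char G B lam" and a: "a \<in> carrier G"
    and k: "k > 0" "a [^] k \<in> B" and k_min: "\<And>m. \<lbrakk>0 < m; m < k\<rbrakk> \<Longrightarrow> a [^] (m::nat) \<notin> B"
    and w: "w ^ k = lam (a [^] k)"
  obtains mu where "lin_char G (generate G (insert a B)) mu" "mu a = w" "\<And>b. b \<in> B \<Longrightarrow> mu b = lam b"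
proof -
  interpret B: subgroup B G by fact
  have lamm: "lam (x \<otimes> y) = lam x * lam y" if "x \<in> B" "y \<in> B" for x y
    using lam that by (simp add: lin_char_def)
  have lam_pow: "lam (a [^] m) = w ^ m" if m: "a [^] m \<in> B" for m :: nat
  proof -
    have akq: "(a [^] k) [^] (m div k) \<in> B" using subgroup_pow_closed[OF B k(2)] .
    have am: "a [^] m = (a [^] k) [^] (m div k) \<otimes> a [^] (m mod k)"
      using a by (simp add: nat_pow_pow nat_pow_mult)
    then have "a [^] (m mod k) = inv ((a [^] k) [^] (m div k)) \<otimes> a [^] m"
      using a by (simp add: mult_inv_cancel)
    then have "a [^] (m mod k) \<in> B" using akq m by simp
    then have 0: "m mod k = 0" using k_min[of "m mod k"] k(1) by auto
    then have "lam (a [^] m) = lam ((a [^] k) [^] (m div k))" using am a by simp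
    also have "\<dots> = w ^ (k * (m div k))" using lin_char_pow[OF lam B k(2)] by (simp add: power_mult w)
    also have "k * (m div k) = m" using 0 by auto
    finally show ?thesis .
  qed
  have wd_le: "w ^ i * lam b = w ^ j * lam c"
    if "b \<in> B" "c \<in> B" "a [^] i \<otimes> b = a [^] j \<otimes> c" "i \<le> j" for i j :: nat and b c
  proof -
    have "a [^] j = a [^] i \<otimes> a [^] (j - i)" using a that(4) by (simp add: nat_pow_mult)
    then have "a [^] i \<otimes> b = a [^] i \<otimes> (a [^] (j - i) \<otimes> c)" using that a by (simp add: m_assoc)
    then have b: "b = a [^] (j - i) \<otimes> c" using a that(1,2) by (simp add: m_closed nat_pow_closed)
    then have "a [^] (j - i) = b \<otimes> inv c" using a that(1,2) by (simp add: m_assoc)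
    then have aB: "a [^] (j - i) \<in> B" using that(1,2) by simp
    have "lam b = w ^ (j - i) * lam c" using b lamm[OF aB that(2)] lam_pow[OF aB] by simp
    then show ?thesis using that(4) by (simp flip: power_add mult.assoc)
  qed
  have wd: "w ^ i * lam b = w ^ j * lam c"
    if "b \<in> B" "c \<in> B" "a [^] i \<otimes> b = a [^] j \<otimes> c" for i j :: nat and b c
    using wd_le[OF that] wd_le[OF that(2,1) that(3)[symmetric]] nat_le_linear[of i j] by auto
  \<comment> \<open>The formula is independent of the chosen expression for \<open>g\<close> by \<open>wd\<close>.\<close>
  define mu where "mu g = (THE v. \<exists>(i::nat) b. b \<in> B \<and> g = a [^] i \<otimes> b \<and> v = w ^ i * lam b)" for g
  have mu: "mu (a [^] i \<otimes> b) = w ^ i * lam b" if "b \<in> B" for i :: nat and b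
    unfolding mu_def
  proof (rule the_equality)
    show "\<exists>(j::nat) c. c \<in> B \<and> a [^] i \<otimes> b = a [^] j \<otimes> c \<and> w ^ i * lam b = w ^ j * lam c"
      using that by blast
    fix v assume "\<exists>(j::nat) c. c \<in> B \<and> a [^] i \<otimes> b = a [^] j \<otimes> c \<and> v = w ^ j * lam c"
    then show "v = w ^ i * lam b" using wd that by metis
  qed
  have elem: "\<exists>(i::nat). \<exists>b\<in>B. g = a [^] i \<otimes> b" if "g \<in> generate G (insert a B)" for g
    using generate_insert_normal[OF _ a k(2,1) that] B subgroup_imp_normal by blast
  show ?thesis
  proof (rule that[of mu])
    have "mu \<one> = 1" using mu[of "\<one>" 0] lam by (simp add: lin_char_def)
    moreover have "mu (g \<otimes> h) = mu g * mu h"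
      if gh: "g \<in> generate G (insert a B)" "h \<in> generate G (insert a B)" for g h
    proof -
      obtain i b where g: "b \<in> B" "g = a [^] (i::nat) \<otimes> b" using elem gh(1) by blast
      obtain j c where h: "c \<in> B" "h = a [^] (j::nat) \<otimes> c" using elem gh(2) by blast
      have "g \<otimes> h = a [^] (i + j) \<otimes> (b \<otimes> c)"
        using g h a by (simp add: nat_pow_mult[symmetric] m_ac)
      then show ?thesis using g h mu by (simp add: lamm power_add)
    qed
    ultimately show "lin_char G (generate G (insert a B)) mu" by (simp add: lin_char_def)
    show "mu a = w" using mu[of "\<one>" 1] a lam by (simp add: lin_char_def)
    show "mu b = lam b" if "b \<in> B" for b using mu[OF that, of 0] that by simp
  qed
qed

lemma least_pow_in_subgroup:
  assumes fin: "finite (carrier G)" and B: "subgroup B G" and a: "a \<in> carrier G"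
  obtains k :: nat where "k > 0" "a [^] k \<in> B" "\<And>m. \<lbrakk>0 < m; m < k\<rbrakk> \<Longrightarrow> a [^] m \<notin> B"
proof -
  define P where "P k \<longleftrightarrow> k > 0 \<and> a [^] k \<in> B" for k :: nat
  have "P (Coset.order G)"
    using fin a subgroup.one_closed[OF B] by (simp add: P_def pow_order_eq_1 order_gt_0_iff_finite)
  then have "P (LEAST k. P k)" by (rule LeastI)
  moreover have "\<not> P m" if "m < (LEAST k. P k)" for m using not_less_Least that by blast
  ultimately show ?thesis using that[of "LEAST k. P k"] unfolding P_def by blast
qed

text \<open>Start with a nontrivial character of the cyclic group generated by \<open>z\<close> and extend it as far as
  possible.\<close>
theorem lin_char_separates:
  assumes fin: "finite (carrier G)" and z: "z \<in> carrier G" "z \<noteq> \<one>"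
  obtains lam where "lin_char G (carrier G) lam" "lam z \<noteq> 1"
proof -
  define P where "P B \<longleftrightarrow> subgroup B G \<and> z \<in> B \<and> (\<exists>lam. lin_char G B lam \<and> lam z \<noteq> 1)" for B
  have one: "subgroup {\<one>} G" by (rule triv_subgroup)
  have "\<exists>B. P B"
  proof -
    obtain k where k: "k > 0" "z [^] k \<in> {\<one>}" "\<And>m. \<lbrakk>0 < m; m < k\<rbrakk> \<Longrightarrow> z [^] (m::nat) \<notin> {\<one>}"
      using least_pow_in_subgroup[OF fin one z(1)] by blast
    then have "k \<noteq> 1" using z by auto
    then have "k \<ge> 2" using k(1) by linarith
    then obtain w :: complex where w: "w ^ k = 1" "w \<noteq> 1" by (rule exists_root_of_unity_ne_one)
    have "lin_char G {\<one>} (\<lambda>_. 1)" by (simp add: lin_char_def)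
    from lin_char_extend_step[OF one this z(1) k, of w] w
    obtain mu where mu: "lin_char G (generate G (insert z {\<one>})) mu" "mu z = w" by metis
    have zc: "insert z {\<one>} \<subseteq> carrier G" using z by simp
    have "P (generate G (insert z {\<one>}))"
      unfolding P_def using mu w(2) generate_is_subgroup[OF zc] generate.incl[of z "insert z {\<one>}" G] by auto
    then show ?thesis by blast
  qed
  then obtain B0 where B0: "P B0" by blast
  have bound: "\<forall>B. P B \<longrightarrow> card B < Suc (card (carrier G))"
    using fin by (auto simp: P_def less_Suc_eq_le intro!: card_mono dest: subgroup.subset)
  obtain B where PB: "P B" and max: "\<And>C. P C \<Longrightarrow> card C \<le> card B"
    using ex_has_greatest_nat[of P B0 card, OF B0] bound by (metis less_imp_le_nat)
  then obtain lam where B: "subgroup B G" and zB: "z \<in> B" and lam: "lin_char G B lam" "lam z \<noteq> 1"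
    by (auto simp: P_def)
  have "B = carrier G"
  proof (rule ccontr)
    assume "B \<noteq> carrier G"
    then obtain a where a: "a \<in> carrier G" "a \<notin> B" using subgroup.subset[OF B] by blast
    obtain k where k: "k > 0" "a [^] k \<in> B" "\<And>m. \<lbrakk>0 < m; m < k\<rbrakk> \<Longrightarrow> a [^] (m::nat) \<notin> B"
      using least_pow_in_subgroup[OF fin B a(1)] by blast
    obtain w where "w ^ k = lam (a [^] k)" using exists_root[OF k(1)] by blast
    from lin_char_extend_step[OF B lam(1) a(1) k this]
    obtain mu where mu: "lin_char G (generate G (insert a B)) mu" "\<And>b. b \<in> B \<Longrightarrow> mu b = lam b" by metis
    have ic: "insert a B \<subseteq> carrier G" using a subgroup.subset[OF B] by simp
    have sub: "insert a B \<subseteq> generate G (insert a B)" by (rule subsetI, rule generate.incl)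
    have "mu z \<noteq> 1" using mu(2)[OF zB] lam(2) by simp
    then have "P (generate G (insert a B))"
      unfolding P_def using mu(1) generate_is_subgroup[OF ic] sub zB by auto
    then have "card (generate G (insert a B)) \<le> card B" by (rule max)
    moreover have "finite (generate G (insert a B))"
      using fin generate_in_carrier[OF ic] by (meson finite_subset subsetI)
    then have "card B < card (generate G (insert a B))"
      using sub a(2) by (intro psubset_card_mono) auto
    ultimately show False by simp
  qed
  then show ?thesis using that lam by blast
qed

end

section \<open>Two sources of the codegree p^2\<close>

lemma codegree_eqI:
  assumes "group G" "finite (carrier G)" "subgroup (char_kernel G \<chi>) G"
    and "Coset.order G = m * card (char_kernel G \<chi>)" "\<chi> \<one>\<^bsub>G\<^esub> = of_nat d"
  shows "codegree G \<chi> = of_nat m / of_nat d"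
proof -
  interpret group G by fact
  have "card (char_kernel G \<chi>) > 0"
    using subgroup.one_closed[OF assms(3)] finite_subset[OF subgroup.subset[OF assms(3)] assms(2)]
    by (auto simp: card_gt_0_iff)
  then have "card (rcosets\<^bsub>G\<^esub> (char_kernel G \<chi>)) = m"
    using lagrange[OF assms(3)] assms(4) by simp
  then show ?thesis by (simp add: codegree_def assms(5))
qed

text \<open>Inflation along \<open>h\<close>. The kernel of the inflated character is the preimage of the kernel, and taking
  preimages is a bijection between their cosets.\<close>
lemma (in group_hom) cod_subset_if_surj:
  assumes surj: "h ` carrier G = carrier H"
  shows "cod H \<subseteq> cod G"
proof
  fix c assume "c \<in> cod H"
  then obtain n \<rho> where \<rho>: "irreducible_rep H n \<rho>" and c: "c = codegree H (character_of H \<rho>)"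
    by (auto simp: cod_def Irr_def)
  let ?\<rho> = "\<rho> \<circ> h" and ?\<chi> = "character_of H \<rho>"
  have "\<rho> \<in> hom H (units_of (ring_mat TYPE(complex) n ()))"
    using \<rho> by (simp only: irreducible_rep_def complex_rep_def)
  then have "?\<rho> \<in> hom G (units_of (ring_mat TYPE(complex) n ()))"
    by (rule Group.hom_compose[OF homh])
  moreover have "W = {0\<^sub>v n} \<or> W = carrier_vec n"
    if W: "VectorSpace.subspace class_ring W (module_vec TYPE(complex) n)"
      and inv: "\<forall>g\<in>carrier G. \<forall>w\<in>W. ?\<rho> g *\<^sub>v w \<in> W" for W
  proof -
    have "\<forall>y\<in>carrier H. \<forall>w\<in>W. \<rho> y *\<^sub>v w \<in> W"
      using inv unfolding surj[symmetric] by simp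
    then show ?thesis using \<rho> W unfolding irreducible_rep_def by blast
  qed
  ultimately have irr: "irreducible_rep G n ?\<rho>"
    using \<rho> by (simp add: irreducible_rep_def complex_rep_def)
  let ?\<psi> = "character_of G ?\<rho>"
  have psi: "?\<psi> g = ?\<chi> (h g)" if "g \<in> carrier G" for g
    using that by (simp add: character_of_def)
  define pre where "pre K = {g \<in> carrier G. h g \<in> K}" for K
  have ker: "char_kernel G ?\<psi> = pre (char_kernel H ?\<chi>)"
    by (auto simp: char_kernel_def pre_def psi)
  have coset: "pre K #> g = pre (K #>\<^bsub>H\<^esub> h g)" if g: "g \<in> carrier G" and K: "K \<subseteq> carrier H" for K g
  proof (intro equalityI subsetI)
    fix x assume "x \<in> pre K #> g"
    then show "x \<in> pre (K #>\<^bsub>H\<^esub> h g)" using g by (auto simp: pre_def r_coset_def)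
  next
    fix x assume "x \<in> pre (K #>\<^bsub>H\<^esub> h g)"
    then obtain k where x: "x \<in> carrier G" and k: "k \<in> K" "h x = k \<otimes>\<^bsub>H\<^esub> h g"
      by (auto simp: pre_def r_coset_def)
    have "h (x \<otimes> inv g) = k" using x g k K by (auto simp: H.m_assoc)
    then have "x \<otimes> inv g \<in> pre K" using x g k by (simp add: pre_def)
    moreover have "x = (x \<otimes> inv g) \<otimes> g" using x g by (simp add: G.m_assoc)
    ultimately show "x \<in> pre K #> g" by (auto simp: r_coset_def)
  qed
  have kH: "char_kernel H ?\<chi> \<subseteq> carrier H" by (auto simp: char_kernel_def)
  have "rcosets\<^bsub>G\<^esub> (char_kernel G ?\<psi>) = pre ` (rcosets\<^bsub>H\<^esub> (char_kernel H ?\<chi>))"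
    unfolding ker RCOSETS_def surj[symmetric] using coset[OF _ kH] by auto
  moreover have "inj_on pre (Pow (carrier H))"
  proof (rule inj_onI)
    fix K L assume KL: "K \<in> Pow (carrier H)" "L \<in> Pow (carrier H)" and "pre K = pre L"
    moreover have "h ` pre K = K" "h ` pre L = L" using KL unfolding surj[symmetric] pre_def by auto
    ultimately show "K = L" by metis
  qed
  then have "inj_on pre (rcosets\<^bsub>H\<^esub> (char_kernel H ?\<chi>))"
    by (rule inj_on_subset) (use H.r_coset_subset_G[OF kH] in \<open>auto simp: RCOSETS_def\<close>)
  ultimately have "card (rcosets\<^bsub>G\<^esub> (char_kernel G ?\<psi>)) = card (rcosets\<^bsub>H\<^esub> (char_kernel H ?\<chi>))"
    by (simp add: card_image)
  then have "codegree G ?\<psi> = c" by (simp add: c codegree_def psi)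
  moreover have "?\<psi> \<in> Irr G" using irr by (auto simp: Irr_def)
  ultimately show "c \<in> cod G" by (auto simp: cod_def)
qed

lemma (in group) hom_mod: "N \<lhd> G \<Longrightarrow> group_hom G (G Mod N) (\<lambda>x. N #> x)"
  by (intro group_hom.intro group_hom_axioms.intro normal.factorgroup_is_group normal.r_coset_hom_Mod)
    (simp_all add: is_group)

lemma (in group) cod_mod: "N \<lhd> G \<Longrightarrow> cod (G Mod N) \<subseteq> cod G"
  using group_hom.cod_subset_if_surj[OF hom_mod] by (simp add: carrier_FactGroup)

lemma (in group_hom) hom_comm:
  "\<lbrakk>x \<in> carrier G; y \<in> carrier G\<rbrakk> \<Longrightarrow> h (G.comm x y) = H.comm (h x) (h y)"
  by (simp add: G.comm_def H.comm_def)

context p_group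
begin

text \<open>A linear character \<open>mu\<close> of \<open>G/G'\<close> with \<open>mu x ^ p \<noteq> 1\<close> has exponent \<open>p\<^sup>r\<close> with \<open>r \<ge> 2\<close>. Its power
  \<open>nu\<close> with exponent \<open>p\<^sup>r\<^sup>-\<^sup>2\<close> takes values in the group of \<open>p\<^sup>2\<close>-th roots of unity, and not only in
  that of \<open>p\<close>-th roots, so the kernel of \<open>nu\<close> has index \<open>p\<^sup>2\<close>.\<close>
theorem prime_square_in_cod_if_derived_quotient_not_elementary:
  assumes x: "x \<in> carrier G" and xp: "x [^] p \<notin> derived G (carrier G)"
  shows "of_nat (p ^ 2) \<in> cod G"
proof -
  let ?D = "derived G (carrier G)"
  have D: "?D \<lhd> G" by (rule derived_self_is_normal)
  interpret Q: comm_group "G Mod ?D" by (rule derived_quot_is_comm_group)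
  interpret h: group_hom G "G Mod ?D" "\<lambda>x. ?D #> x" by (rule hom_mod[OF D])
  have finQ: "finite (carrier (G Mod ?D))" using fin by (simp add: carrier_FactGroup)
  have "?D #> x [^] p \<noteq> \<one>\<^bsub>G Mod ?D\<^esub>"
    using rcos_self[OF _ normal_imp_subgroup[OF D], of "x [^] p"] x xp by auto
  then obtain lam where lam: "lin_char (G Mod ?D) (carrier (G Mod ?D)) lam" "lam (?D #> x [^] p) \<noteq> 1"
    using Q.lin_char_separates[OF finQ h.hom_closed] x by blast
  define mu where "mu g = lam (?D #> g)" for g
  have mu: "lin_char G (carrier G) mu"
    using lam(1) h.hom_closed h.hom_mult h.hom_one by (simp add: lin_char_def mu_def)
  note mu_pow = lin_char_pow[OF mu subgroup_self]
  obtain n where n: "Coset.order G = p ^ n" using ord by blast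
  define P where "P r \<longleftrightarrow> (\<forall>g\<in>carrier G. mu g ^ (p ^ r) = 1)" for r
  have "P n" unfolding P_def
    using mu_pow[of _ "p ^ n"] pow_order_eq_1[of _] mu n by (simp add: lin_char_def)
  define r where "r = (LEAST r. P r)"
  have Pr: "P r" unfolding r_def using \<open>P n\<close> by (rule LeastI)
  have r_min: "\<not> P s" if "s < r" for s using not_less_Least[of s P] that r_def by blast
  have mux: "mu x ^ p \<noteq> 1" using lam(2) mu_pow[OF x, of p] by (simp add: mu_def)
  have "r \<ge> 2"
  proof (rule ccontr)
    assume "\<not> 2 \<le> r"
    then have "p = p ^ r * p ^ (1 - r)" by (simp flip: power_add)
    moreover have "mu x ^ (p ^ r) = 1" using Pr x by (simp add: P_def)
    ultimately show False using mux by (metis power_mult power_one)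
  qed
  then have r: "r = (r - 2) + 2" "r - 1 = (r - 2) + 1" "r - 1 < r" by linarith+
  have pr: "p ^ r = p ^ (r - 2) * p ^ 2" "p ^ (r - 1) = p ^ (r - 2) * p"
    using r(1,2) by (metis power_add, metis power_add power_one_right)
  define nu where "nu g = mu g ^ (p ^ (r - 2))" for g
  have nu: "lin_char G (carrier G) nu"
    using mu by (simp add: lin_char_def nu_def power_mult_distrib)
  have nu_mult: "nu (a \<otimes> b) = nu a * nu b" if "a \<in> carrier G" "b \<in> carrier G" for a b
    using nu that by (simp add: lin_char_def)
  have nu_one: "nu \<one> = 1" using nu by (simp add: lin_char_def)
  note nu_pow = lin_char_pow[OF nu subgroup_self]
  have nu_p2: "nu g ^ (p ^ 2) = 1" if "g \<in> carrier G" for g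
  proof -
    have "nu g ^ (p ^ 2) = mu g ^ (p ^ r)" by (simp only: nu_def pr flip: power_mult)
    then show ?thesis using Pr that by (simp add: P_def)
  qed
  obtain g where g: "g \<in> carrier G" "mu g ^ (p ^ (r - 1)) \<noteq> 1" using r_min[OF r(3)] by (auto simp: P_def)
  have gp: "nu g ^ p \<noteq> 1" using g(2) by (simp only: nu_def pr power_mult not_False_eq_True)
  have nu_inv: "nu (inv a) * nu a = 1" if "a \<in> carrier G" for a
    using nu_mult[of "inv a" a] that nu_one by simp
  define K where "K m = {a \<in> carrier G. nu a ^ m = 1}" for m :: nat
  have K: "subgroup (K m) G" for m
  proof (rule subgroupI)
    show "K m \<noteq> {}" using nu_one by (auto simp: K_def)
    show "inv a \<in> K m" if "a \<in> K m" for a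
      using that nu_inv[of a] power_mult_distrib[of "nu (inv a)" "nu a" m] by (auto simp: K_def)
  qed (auto simp: K_def nu_mult power_mult_distrib)
  have "nu (b \<otimes> a \<otimes> inv b) = nu a" if "a \<in> carrier G" "b \<in> carrier G" for a b
    using nu_inv[of b] that by (simp add: nu_mult mult.commute)
  then have ker: "{a \<in> carrier G. \<forall>b\<in>carrier G. nu (b \<otimes> a \<otimes> inv b) = 1} = K 1"
    by (auto simp: K_def)
  obtain \<chi> where \<chi>: "\<chi> \<in> Irr G" "\<chi> \<one> = of_nat (Coset.order G div card (carrier G))"
    "char_kernel G \<chi> = {a \<in> carrier G. \<forall>b\<in>carrier G. nu (b \<otimes> a \<otimes> inv b) = 1}"
    using monomial_character[OF normal_self fin, of nu] nu_mult nu_one by blast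
  have "0 < Coset.order G" using fin order_gt_0_iff_finite by simp
  then have "Coset.order G div card (carrier G) = 1" unfolding Coset.order_def by (rule div_self[OF neq0_conv[THEN iffD2]])
  then have chi1: "\<chi> \<one> = of_nat 1" using \<chi>(2) by (simp only:)
  have "card (carrier G) \<le> card {z::complex. z ^ (p ^ 2) = 1} * card (K 1)"
  proof (rule card_le_fibre[OF fin, where f = nu])
    show "finite {z::complex. z ^ p\<^sup>2 = 1}" by (rule finite_roots_unity) (simp add: Suc_leI)
    show "nu ` carrier G \<subseteq> {z. z ^ p\<^sup>2 = 1}" using nu_p2 by auto
    fix a b assume "a \<in> carrier G" "b \<in> carrier G" "nu a = nu b"
    then show "inv a \<otimes> b \<in> K 1" using nu_inv[of a] by (simp add: K_def nu_mult)
  qed (auto simp: K_def)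
  then have le: "Coset.order G \<le> p ^ 2 * card (K 1)"
    by (simp add: Coset.order_def card_roots_unity_eq)
  have "K 1 \<subset> K p"
  proof
    have "g [^] p \<in> K p" "g [^] p \<notin> K 1"
      using nu_pow[OF g(1), of p] gp nu_p2[OF g(1)] g(1) by (simp_all add: K_def power2_eq_square power_mult)
    then show "K 1 \<noteq> K p" by blast
  qed (auto simp: K_def)
  then have "p * card (K 1) \<le> card (K p)" using subgroup_index K by blast
  moreover have "K p \<subset> carrier G" using g gp by (auto simp: K_def)
  then have "p * card (K p) \<le> Coset.order G"
    using subgroup_index K subgroup_self by (simp add: Coset.order_def)
  ultimately have "p ^ 2 * card (K 1) \<le> Coset.order G"
    by (metis le_trans mult.assoc mult_le_mono2 power2_eq_square)
  then have "codegree G \<chi> = of_nat (p ^ 2) / of_nat 1"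
    using le K \<chi>(3) ker chi1 by (intro codegree_eqI is_group fin) auto
  then show ?thesis using \<chi>(1) by (auto simp: cod_def image_iff intro: bexI[of _ \<chi>])
qed

text \<open>Let \<open>Z\<close> be the centre and \<open>A\<close> the centralizer of a noncentral element \<open>a\<close>. The strict chain
  \<open>1 < Z < A < G\<close> fits into order at most \<open>p\<^sup>3\<close> only with all indices equal to \<open>p\<close>; so \<open>A\<close> is generated by
  \<open>a\<close> and \<open>Z\<close>, and is abelian. A character \<open>lam\<close> of \<open>A\<close> that is nontrivial on \<open>Z\<close> is injective on
  \<open>Z\<close>. An element \<open>g\<close> outside \<open>A\<close> changes \<open>lam a\<close> by the factor \<open>lam [g,a] \<noteq> 1\<close>, so \<open>lam\<close> induces to
  an irreducible character of degree \<open>p\<close>; for the same reason the induced character is faithful.\<close>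
theorem prime_square_in_cod_if_nonabelian_order_p3:
  assumes le: "Coset.order G \<le> p ^ 3"
    and ab: "a \<in> carrier G" "b \<in> carrier G" "comm a b \<noteq> \<one>"
    and central: "\<And>x y z. \<lbrakk>x \<in> carrier G; y \<in> carrier G; z \<in> carrier G\<rbrakk> \<Longrightarrow> comm (comm x y) z = \<one>"
  shows "of_nat (p ^ 2) \<in> cod G"
proof -
  define Z where "Z = cent_mod {\<one>} (carrier G)"
  define A where "A = cent_mod {\<one>} {a}"
  have Z: "subgroup Z G" unfolding Z_def by (rule subgroup_cent_mod[OF one_is_normal]) simp
  have A: "subgroup A G" unfolding A_def by (rule subgroup_cent_mod[OF one_is_normal]) (use ab in simp)
  have commZ: "comm x y \<in> Z" if "x \<in> carrier G" "y \<in> carrier G" for x y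
    using that central by (simp add: Z_def cent_mod_def)
  have ZA: "Z \<subseteq> A" using ab by (auto simp: Z_def A_def cent_mod_def)
  have aA: "a \<in> A" "a \<notin> Z" using ab by (auto simp: Z_def A_def cent_mod_def)
  have "comm b a \<noteq> \<one>" using ab comm_eq_one_iff[of a b] comm_eq_one_iff[of b a] by simp
  then have bA: "b \<notin> A" by (simp add: A_def cent_mod_def)
  have "{\<one>} \<subset> Z" using subgroup.one_closed[OF Z] commZ[OF ab(1,2)] ab(3) by auto
  then have 1: "p \<le> card Z" using subgroup_index[OF triv_subgroup Z] by simp
  have 2: "p * card Z \<le> card A" using subgroup_index[OF Z A] ZA aA by blast
  have 3: "p * card A \<le> Coset.order G"
    using subgroup_index[OF A subgroup_self] subgroup.subset[OF A] bA ab by (auto simp: Coset.order_def)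
  have "p * card A \<le> p ^ 3" using 3 le by linarith
  then have "p * card A \<le> p * (p * p)" by (simp only: power3_eq_cube mult.assoc)
  then have A_le: "card A \<le> p * p" by simp
  then have "p * card Z \<le> p * p" using 2 by linarith
  then have cardZ: "card Z = p" using 1 by simp
  then have cardA: "card A = p * p" using 2 A_le by simp
  then have cardG: "Coset.order G = p ^ 3" using 3 le by (simp add: power3_eq_cube)
  have A_gen: "A = generate G (insert a Z)"
    using eq_generate_insert[OF Z A aA ZA] cardA cardZ by simp
  have A_comm: "comm y x = \<one>" if "x \<in> A" "y \<in> A" for x y
  proof -
    have xc: "x \<in> carrier G" using subgroup.mem_carrier[OF A that(1)] .
    have sub: "subgroup (cent_mod {\<one>} {x}) G"
      by (rule subgroup_cent_mod[OF one_is_normal]) (use xc in simp)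
    have "comm a x = \<one>"
      using that(1) ab(1) comm_eq_one_iff[of a x] comm_eq_one_iff[of x a] xc by (simp add: A_def cent_mod_def)
    then have "a \<in> cent_mod {\<one>} {x}" using ab by (simp add: cent_mod_def)
    moreover have "Z \<subseteq> cent_mod {\<one>} {x}" using xc by (auto simp: Z_def cent_mod_def)
    ultimately have "A \<subseteq> cent_mod {\<one>} {x}" unfolding A_gen by (intro generate_insert_least sub)
    then show ?thesis using that(2) by (auto simp: cent_mod_def)
  qed
  have A_normal: "A \<lhd> G"
    by (rule normal_if_comm_closed[OF A]) (use commZ ZA subgroup.mem_carrier[OF A] in blast)
  interpret GA: comm_group "G\<lparr>carrier := A\<rparr>"
  proof (rule group.group_comm_groupI)
    show "group (G\<lparr>carrier := A\<rparr>)" using subgroup.subgroup_is_group[OF A is_group] .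
    fix x y assume "x \<in> carrier (G\<lparr>carrier := A\<rparr>)" "y \<in> carrier (G\<lparr>carrier := A\<rparr>)"
    then show "x \<otimes>\<^bsub>G\<lparr>carrier := A\<rparr>\<^esub> y = y \<otimes>\<^bsub>G\<lparr>carrier := A\<rparr>\<^esub> x"
      using A_comm comm_eq_one_iff subgroup.mem_carrier[OF A] by simp
  qed
  obtain z where z: "z \<in> Z" "z \<noteq> \<one>" using \<open>{\<one>} \<subset> Z\<close> by blast
  have finA: "finite (carrier (G\<lparr>carrier := A\<rparr>))" using finite_subgroup[OF A] by simp
  obtain lam where lam: "lin_char (G\<lparr>carrier := A\<rparr>) (carrier (G\<lparr>carrier := A\<rparr>)) lam" "lam z \<noteq> 1"
    using GA.lin_char_separates[OF finA, of z] z ZA by auto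
  have lam_mult: "lam (x \<otimes> y) = lam x * lam y" if "x \<in> A" "y \<in> A" for x y
    using lam(1) that by (simp add: lin_char_def)
  have lam_one: "lam \<one> = 1" using lam(1) by (simp add: lin_char_def)
  define K where "K = {c \<in> Z. lam c = 1}"
  have K: "subgroup K G"
  proof (rule subgroupI)
    show "K \<subseteq> carrier G" using subgroup.subset[OF Z] by (auto simp: K_def)
    show "K \<noteq> {}" using subgroup.one_closed[OF Z] lam_one by (auto simp: K_def)
    fix c assume c: "c \<in> K"
    then have cZ: "c \<in> Z" "lam c = 1" by (auto simp: K_def)
    then have ic: "inv c \<in> Z" using subgroup.m_inv_closed[OF Z] by blast
    have "lam (inv c \<otimes> c) = lam (inv c) * lam c" using ic cZ ZA by (intro lam_mult) auto
    then show "inv c \<in> K" using ic cZ lam_one subgroup.mem_carrier[OF Z] by (simp add: K_def)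
    fix d assume d: "d \<in> K"
    then show "c \<otimes> d \<in> K" using cZ ZA lam_mult[of c d] subgroup.m_closed[OF Z, of c d] by (auto simp: K_def)
  qed
  have "K \<subset> Z" using z lam(2) by (auto simp: K_def)
  then have "p * card K \<le> p * 1" using subgroup_index[OF K Z] cardZ by simp
  then have "card K \<le> 1" by simp
  then have K1: "c = \<one>" if "c \<in> Z" "lam c = 1" for c
    using card_le_Suc0_iff_eq[OF finite_subgroup[OF K]] subgroup.one_closed[OF K] that by (auto simp: K_def)
  have conj: "lam (g \<otimes> c \<otimes> inv g) = lam (comm g c) * lam c" if "g \<in> carrier G" "c \<in> A" for g c
    using that lam_mult[of "comm g c" c] commZ[of g c] ZA subgroup.mem_carrier[OF A that(2)]
    by (auto simp: conj_eq_comm_mult)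
  obtain \<chi> where \<chi>: "\<chi> \<in> Irr G" "\<chi> \<one> = of_nat (Coset.order G div card A)"
    "char_kernel G \<chi> = {c \<in> A. \<forall>g\<in>carrier G. lam (g \<otimes> c \<otimes> inv g) = 1}"
  proof (rule monomial_character[OF A_normal fin, of lam])
    fix g assume g: "g \<in> carrier G" "g \<notin> A"
    then have "comm g a \<noteq> \<one>" by (simp add: A_def cent_mod_def)
    then have "lam (comm g a) \<noteq> 1" using K1 commZ[of g a] g ab by blast
    moreover have "lam a \<noteq> 0"
    proof
      assume "lam a = 0"
      then show False
        using lam_mult[OF subgroup.m_inv_closed[OF A aA(1)] aA(1)] lam_one ab(1) by simp
    qed
    ultimately have "lam (g \<otimes> a \<otimes> inv g) \<noteq> lam a" using conj[OF g(1) aA(1)] by simp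
    then show "\<exists>c\<in>A. lam (g \<otimes> c \<otimes> inv g) \<noteq> lam c" using aA(1) by blast
  qed (use lam_mult lam_one in auto)
  have "char_kernel G \<chi> = {\<one>}"
  proof (intro equalityI subsetI)
    fix c assume "c \<in> char_kernel G \<chi>"
    then have c: "c \<in> A" "\<And>g. g \<in> carrier G \<Longrightarrow> lam (g \<otimes> c \<otimes> inv g) = 1" using \<chi>(3) by auto
    have cc: "c \<in> carrier G" using subgroup.mem_carrier[OF A c(1)] .
    have lc: "lam c = 1" using c(2)[OF one_closed] cc by simp
    have "comm c g = \<one>" if g: "g \<in> carrier G" for g
    proof -
      have "lam (comm g c) = 1" using conj[OF g c(1)] c(2)[OF g] lc by simp
      then have "comm g c = \<one>" using K1 commZ g cc by blast
      then show ?thesis using comm_eq_one_iff[of g c] comm_eq_one_iff[of c g] g cc by simp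
    qed
    then have "c \<in> Z" using cc by (simp add: Z_def cent_mod_def)
    then show "c \<in> {\<one>}" using K1 lc by blast
  qed (use \<chi>(3) subgroup.one_closed[OF A] lam_one in simp)
  moreover have "\<chi> \<one> = of_nat p" using \<chi>(2) cardG cardA by (simp add: power3_eq_cube)
  ultimately have "codegree G \<chi> = of_nat (p ^ 3) / of_nat p"
    using cardG triv_subgroup by (intro codegree_eqI is_group fin) auto
  also have "\<dots> = of_nat (p ^ 2)" by (simp add: power3_eq_cube power2_eq_square)
  finally show ?thesis using \<chi>(1) by (auto simp: cod_def image_iff intro: bexI[of _ \<chi>])
qed

lemma p_group_mod:
  assumes "N \<lhd> G"
  shows "p_group (G Mod N) p"
proof -
  have "card (rcosets N) dvd Coset.order G"
    using lagrange[OF normal_imp_subgroup[OF assms]] by (metis dvd_triv_left)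
  then have "\<exists>n. Coset.order (G Mod N) = p ^ n"
    using ord divides_primepow_nat[OF prime_p] by (auto simp: Coset.order_def FactGroup_def)
  then show ?thesis
    using fin normal.factorgroup_is_group[OF assms] prime_p
    by (intro p_group.intro p_group_axioms.intro) (auto simp: carrier_FactGroup)
qed

theorem prime_square_in_cod_if_nonabelian_quotient:
  assumes M: "M \<lhd> G" and le: "Coset.order G \<le> p ^ 3 * card M"
    and ab: "a \<in> carrier G" "b \<in> carrier G" "comm a b \<notin> M"
    and central: "\<And>x y z. \<lbrakk>x \<in> carrier G; y \<in> carrier G; z \<in> carrier G\<rbrakk> \<Longrightarrow> comm (comm x y) z \<in> M"
  shows "of_nat (p ^ 2) \<in> cod G"
proof -
  interpret Q: p_group "G Mod M" p by (rule p_group_mod[OF M])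
  interpret h: group_hom G "G Mod M" "\<lambda>x. M #> x" by (rule hom_mod[OF M])
  have Ms: "subgroup M G" using normal_imp_subgroup[OF M] .
  have surj: "\<exists>x\<in>carrier G. X = M #> x" if "X \<in> carrier (G Mod M)" for X
    using that by (auto simp: carrier_FactGroup)
  have one: "M #> x = \<one>\<^bsub>G Mod M\<^esub> \<longleftrightarrow> x \<in> M" if "x \<in> carrier G" for x
    using that coset_join1[OF _ _ Ms, of x] coset_join2[OF _ Ms, of x] subgroup.subset[OF Ms] by auto
  have "card M > 0" using subgroup.one_closed[OF Ms] finite_subgroup[OF Ms] card_gt_0_iff by blast
  moreover have "Coset.order (G Mod M) * card M = Coset.order G"
    using lagrange[OF Ms] by (simp add: Coset.order_def FactGroup_def)
  then have "Coset.order (G Mod M) * card M \<le> p ^ 3 * card M" using le by simp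
  ultimately have "Coset.order (G Mod M) \<le> p ^ 3" by simp
  moreover have "Q.comm (M #> a) (M #> b) \<noteq> \<one>\<^bsub>G Mod M\<^esub>"
    using h.hom_comm[of a b] ab one[of "comm a b"] by simp
  moreover have "Q.comm (Q.comm X Y) V = \<one>\<^bsub>G Mod M\<^esub>"
    if "X \<in> carrier (G Mod M)" "Y \<in> carrier (G Mod M)" "V \<in> carrier (G Mod M)" for X Y V
  proof -
    note XYV = that
    obtain x where x: "x \<in> carrier G" "X = M #> x" using surj[OF XYV(1)] by blast
    obtain y where y: "y \<in> carrier G" "Y = M #> y" using surj[OF XYV(2)] by blast
    obtain v where v: "v \<in> carrier G" "V = M #> v" using surj[OF XYV(3)] by blast
    note * = x y v
    then have "Q.comm (Q.comm X Y) V = M #> comm (comm x y) v" using h.hom_comm by simp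
    also have "\<dots> = \<one>\<^bsub>G Mod M\<^esub>" using one central * by simp
    finally show ?thesis .
  qed
  ultimately have "of_nat (p ^ 2) \<in> cod (G Mod M)"
    using ab by (intro Q.prime_square_in_cod_if_nonabelian_order_p3[of "M #> a" "M #> b"] h.hom_closed) auto
  then show ?thesis using cod_mod[OF M] by blast
qed

end

section \<open>Groups of class three with a third term of order p\<close>

text \<open>The situation after the reduction: \<open>D\<close> and \<open>T\<close> are the second and third terms of the lower
  central series, and \<open>pow_D\<close> is what remains when \<open>G/G'\<close> provides no character of order \<open>p\<^sup>2\<close>.\<close>
locale class3_p_group = p_group G p for G (structure) and p +
  fixes D T :: "'a set"
  assumes D_def: "D = derived G (carrier G)"
    and T: "subgroup T G" and card_T: "card T = p" and TD: "T \<subseteq> D"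
    and T_central: "\<And>t g. \<lbrakk>t \<in> T; g \<in> carrier G\<rbrakk> \<Longrightarrow> comm t g = \<one>"
    and comm_DG: "\<And>d g. \<lbrakk>d \<in> D; g \<in> carrier G\<rbrakk> \<Longrightarrow> comm d g \<in> T"
    and D_noncentral: "\<exists>d\<in>D. \<exists>g\<in>carrier G. comm d g \<noteq> \<one>"
    and pow_D: "\<And>x. x \<in> carrier G \<Longrightarrow> x [^] p \<in> D"
    and order_le: "Coset.order G \<le> p ^ 6"
begin

definition ZD :: "'a set" where "ZD = D \<inter> cent_mod {\<one>} (carrier G)"
definition C :: "'a set" where "C = cent_mod {\<one>} D"

lemma p_gt_1: "p > 1" using prime_p prime_gt_1_nat by blast

lemma D_normal: "D \<lhd> G" unfolding D_def by (rule derived_self_is_normal)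
lemma D_subgroup: "subgroup D G" using D_normal normal_imp_subgroup by blast
lemma D_carrier: "d \<in> D \<Longrightarrow> d \<in> carrier G" using subgroup.mem_carrier[OF D_subgroup] .
lemma T_carrier: "t \<in> T \<Longrightarrow> t \<in> carrier G" using subgroup.mem_carrier[OF T] .
lemma comm_D: "\<lbrakk>x \<in> carrier G; y \<in> carrier G\<rbrakk> \<Longrightarrow> comm x y \<in> D" unfolding D_def by (rule comm_in_derived)
lemma comm_GD: "\<lbrakk>g \<in> carrier G; d \<in> D\<rbrakk> \<Longrightarrow> comm g d \<in> T"
  using comm_commute[OF T D_carrier _ comm_DG] .
lemma one_T: "\<one> \<in> T" using subgroup.one_closed[OF T] .

lemma normal_above_T: "\<lbrakk>subgroup N G; T \<subseteq> N; N \<subseteq> D\<rbrakk> \<Longrightarrow> N \<lhd> G"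
  by (rule normal_if_comm_closed) (use comm_DG in auto)

lemma T_normal: "T \<lhd> G" using normal_above_T[OF T _ TD] by simp

lemma T_pow:
  assumes "t \<in> T"
  shows "t [^] p = \<one>"
proof -
  have "t [^]\<^bsub>G\<lparr>carrier := T\<rparr>\<^esub> Coset.order (G\<lparr>carrier := T\<rparr>) = \<one>\<^bsub>G\<lparr>carrier := T\<rparr>\<^esub>"
    using assms by (intro group.pow_order_eq_1[OF subgroup.subgroup_is_group[OF T is_group]]) simp
  then show ?thesis by (simp add: Coset.order_def card_T flip: nat_pow_consistent)
qed

lemma D_abelian:
  assumes "d \<in> D" "d' \<in> D"
  shows "comm d d' = \<one>"
proof -
  have dc: "d \<in> carrier G" using D_carrier assms by simp
  have "D \<subseteq> cent_mod {\<one>} {d}" unfolding D_def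
  proof (rule derived_least)
    show "subgroup (cent_mod {\<one>} {d}) G" by (rule subgroup_centralizer) (use dc in simp)
    fix x y assume xy: "x \<in> carrier G" "y \<in> carrier G"
    have "comm d (comm x y) = \<one>"
      by (rule comm_comm_trivial) (use xy dc T_central comm_DG[OF assms(1)] T_carrier in simp_all)
    then show "comm x y \<in> cent_mod {\<one>} {d}"
      using xy dc comm_eq_one_sym by (simp add: in_centralizer_iff)
  qed
  then show ?thesis using assms(2) dc comm_eq_one_sym D_carrier by (auto simp: in_centralizer_iff)
qed

lemma C_subgroup: "subgroup C G" unfolding C_def
  by (rule subgroup_centralizer) (use D_carrier in blast)
lemma C_carrier: "c \<in> C \<Longrightarrow> c \<in> carrier G" using subgroup.mem_carrier[OF C_subgroup] .
lemma CI: "\<lbrakk>c \<in> carrier G; \<And>d. d \<in> D \<Longrightarrow> comm c d = \<one>\<rbrakk> \<Longrightarrow> c \<in> C" by (simp add: C_def cent_mod_def)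
lemma CD: "\<lbrakk>c \<in> C; d \<in> D\<rbrakk> \<Longrightarrow> comm c d = \<one>" by (simp add: C_def cent_mod_def)
lemma D_le_C: "D \<subseteq> C" using CI D_abelian D_carrier by blast

lemma ZDI: "\<lbrakk>d \<in> D; \<And>g. g \<in> carrier G \<Longrightarrow> comm d g = \<one>\<rbrakk> \<Longrightarrow> d \<in> ZD"
  using D_carrier by (simp add: ZD_def cent_mod_def)
lemma ZD_central: "\<lbrakk>d \<in> ZD; g \<in> carrier G\<rbrakk> \<Longrightarrow> comm d g = \<one>" by (simp add: ZD_def cent_mod_def)
lemma ZD_le_D: "ZD \<subseteq> D" by (simp add: ZD_def)
lemma T_le_ZD: "T \<subseteq> ZD" using ZDI T_central TD by blast
lemma ZD_subgroup: "subgroup ZD G" unfolding ZD_def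
  by (intro subgroups_Inter_pair D_subgroup subgroup_centralizer) simp
lemma ZD_normal: "ZD \<lhd> G" by (rule normal_above_T[OF ZD_subgroup T_le_ZD ZD_le_D])

text \<open>Conjugation by any \<open>z\<close> changes \<open>x\<close> and \<open>y\<close> by elements of \<open>D\<close>, which commute with \<open>x\<close>, \<open>y\<close> and
  each other.\<close>
lemma comm_centralizers_central:
  assumes "x \<in> C" "y \<in> C"
  shows "comm x y \<in> ZD"
proof (rule ZDI)
  have c: "x \<in> carrier G" "y \<in> carrier G" using assms C_carrier by auto
  show "comm x y \<in> D" using c comm_D by simp
  fix z assume z: "z \<in> carrier G"
  have D: "comm z x \<in> D" "comm z y \<in> D" using c z comm_D by simp_all
  have DC: "comm d c = \<one>" if "d \<in> D" "c \<in> C" for c d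
    using CD[OF that(2,1)] comm_eq_one_sym[of c d] C_carrier D_carrier that by simp
  have "comm z (comm x y) = \<one>"
    by (rule comm_comm_trivial[OF c z]) (use D DC assms D_abelian in simp_all)
  then show "comm (comm x y) z = \<one>" using comm_eq_one_sym c z by simp
qed

lemma pow_D_central:
  assumes "d \<in> D"
  shows "d [^] p \<in> ZD"
proof (rule ZDI)
  show "d [^] p \<in> D" using subgroup_pow_closed[OF D_subgroup assms] .
  fix g assume g: "g \<in> carrier G"
  have d: "d \<in> carrier G" using D_carrier assms by simp
  have t: "comm d g \<in> T" using comm_DG[OF assms g] .
  have "comm (d [^] p) g = comm d g [^] p"
  proof (rule comm_pow_left[OF d g])
    show "d \<otimes> comm d g = comm d g \<otimes> d"
      using T_central[OF t d] comm_eq_one_iff[of "comm d g" d] d g by simp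
  qed
  then show "comm (d [^] p) g = \<one>" using T_pow[OF t] by simp
qed

lemma card_centralizer_le:
  assumes "d \<in> D" "subgroup K G"
  shows "card K \<le> p * card (K \<inter> cent_mod {\<one>} {d})"
  using assms comm_GD D_carrier subgroup.mem_carrier[OF assms(2)] one_T card_T
  by (intro card_cent_mod_le[OF fin one_is_normal assms(2) _ T]) simp_all

lemma card_centralizer_in_D_le:
  assumes "g \<in> carrier G" "subgroup K G" "K \<subseteq> D"
  shows "card K \<le> p * card (K \<inter> cent_mod {\<one>} {g})"
  using assms comm_DG one_T card_T
  by (intro card_cent_mod_le[OF fin one_is_normal assms(2) _ T]) auto

lemma prime_square_in_cod_if_normal:
  assumes M: "M \<lhd> G" "Coset.order G \<le> p ^ 3 * card M" "\<not> D \<subseteq> M" "T \<subseteq> M"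
  shows "of_nat (p ^ 2) \<in> cod G"
proof -
  obtain a b where "a \<in> carrier G" "b \<in> carrier G" "comm a b \<notin> M"
    using derived_least[OF normal_imp_subgroup[OF M(1)]] M(3) unfolding D_def by blast
  then show ?thesis
    by (rule prime_square_in_cod_if_nonabelian_quotient[OF M(1,2)]) (use comm_DG comm_D M(4) in blast)
qed

text \<open>The quotient by the subgroup \<open>M\<close> generated by \<open>x\<close> and \<open>N\<close>. It does not contain \<open>D\<close>, because
  \<open>|M| \<le> p |N| = |D|\<close> and \<open>x\<close> lies in \<open>M\<close> but not in \<open>D\<close>.\<close>
lemma prime_square_in_cod_if_radical_generator:
  assumes N: "subgroup N G" "T \<subseteq> N" "N \<subseteq> D" "p * card N = card D"
    and le: "Coset.order G \<le> p ^ 3 * card D"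
    and x: "x \<in> carrier G" "x \<notin> D" "x [^] p \<in> N" "\<And>g. g \<in> carrier G \<Longrightarrow> comm x g \<in> N"
  shows "of_nat (p ^ 2) \<in> cod G"
proof -
  have Nn: "N \<lhd> G" using normal_above_T N by simp
  let ?M = "generate G (insert x N)"
  have M: "subgroup ?M G" "N \<subseteq> ?M" "x \<in> ?M" using generate_insert[OF N(1) x(1)] .
  have "?M \<subseteq> cent_mod N (carrier G)"
  proof (rule generate_insert_least)
    show "subgroup (cent_mod N (carrier G)) G" by (rule subgroup_cent_mod[OF Nn]) simp
    show "x \<in> cent_mod N (carrier G)" using x by (simp add: cent_mod_def)
    show "N \<subseteq> cent_mod N (carrier G)"
      using comm_DG N(2,3) D_carrier by (auto simp: cent_mod_def)
  qed
  then have Mn: "?M \<lhd> G"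
    using M(2) by (intro normal_if_comm_closed[OF M(1)]) (auto simp: cent_mod_def)
  have "x \<notin> N" using x(2) N(3) by blast
  then have ge: "p * card N \<le> card ?M" using card_generate_ge[OF N(1) x(1)] by simp
  then have "p ^ 3 * card D \<le> p ^ 3 * card ?M" using N(4) by simp
  then have "Coset.order G \<le> p ^ 3 * card ?M" using le by linarith
  moreover have "\<not> D \<subseteq> ?M"
  proof
    assume "D \<subseteq> ?M"
    then have "D \<subset> ?M" using M(3) x(2) by blast
    then have "p * card D \<le> card ?M" using subgroup_index[OF D_subgroup M(1)] by simp
    also have "\<dots> \<le> p * card N" by (rule card_generate_le[OF Nn x(1,3)])
    finally have "p * card D \<le> 1 * card D" using N(4) by simp
    moreover have "card D > 0"
      using finite_subgroup[OF D_subgroup] subgroup.one_closed[OF D_subgroup] by (auto simp: card_gt_0_iff)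
    ultimately show False using p_gt_1 by (simp only: mult_le_cancel2) simp
  qed
  ultimately show ?thesis using prime_square_in_cod_if_normal[OF Mn] N(2) M(2) by blast
qed

end

section \<open>Centre of index p in the derived subgroup\<close>

context class3_p_group
begin

lemma comm_pow_in_T:
  assumes "x \<in> carrier G" "g \<in> carrier G" "comm x g \<in> T"
  shows "comm (x [^] p) g = \<one>"
proof -
  have "comm (x [^] p) g = comm x g [^] p"
    by (rule comm_pow_left[OF assms(1,2)]) (use T_central[OF assms(3,1)] comm_eq_one_iff assms in simp)
  then show ?thesis using T_pow[OF assms(3)] by simp
qed

text \<open>The element \<open>[x,y]\<close> commutes with both \<open>x\<close> and \<open>y\<close>, hence \<open>[x\<^sup>p,y] = [x,y]\<^sup>p = [x,y\<^sup>p]\<close>, and \<open>y\<^sup>p\<close>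
  lies in \<open>D\<close>.\<close>
lemma comm_pow_both:
  assumes "x \<in> C" "y \<in> carrier G" "comm (comm x y) y = \<one>"
  shows "comm (x [^] p) y = \<one>"
proof -
  have xc: "x \<in> carrier G" using C_carrier assms by simp
  have "comm x (comm x y) = \<one>" using CD[OF assms(1) comm_D] xc assms(2) by simp
  then have "comm (x [^] p) y = comm x y [^] p"
    by (intro comm_pow_left[OF xc assms(2)]) (use comm_eq_one_iff xc assms(2) in simp)
  also have "\<dots> = comm x (y [^] p)"
    by (rule comm_pow_right[OF xc assms(2), symmetric]) (use assms comm_eq_one_iff xc in simp)
  also have "\<dots> = \<one>" using CD[OF assms(1) pow_D] assms by simp
  finally show ?thesis .
qed

text \<open>A subgroup \<open>M\<close> of \<open>R\<close> that is maximal among those containing \<open>N\<close> but not \<open>d\<close>. Adding any further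
  \<open>y\<close> of \<open>R\<close> to \<open>M\<close> gives a subgroup of order at most \<open>p |M|\<close> that contains \<open>d\<close>, so it is the
  subgroup generated by \<open>d\<close> and \<open>M\<close>; hence the latter is all of \<open>R\<close>.\<close>
lemma exists_complement:
  assumes N: "subgroup N G" "N \<subseteq> R" "d \<notin> N" and R: "subgroup R G" "d \<in> R"
    and comm_R: "\<And>x g. \<lbrakk>x \<in> R; g \<in> carrier G\<rbrakk> \<Longrightarrow> comm x g \<in> N"
    and pow_R: "\<And>x. x \<in> R \<Longrightarrow> x [^] p \<in> N"
  obtains M where "M \<lhd> G" "N \<subseteq> M" "d \<notin> M" "card R \<le> p * card M"
proof -
  define P where "P M \<longleftrightarrow> subgroup M G \<and> N \<subseteq> M \<and> M \<subseteq> R \<and> d \<notin> M" for M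
  have "P N" using N by (simp add: P_def)
  have "\<forall>M. P M \<longrightarrow> card M < Suc (card R)"
    using card_mono[OF finite_subgroup[OF R(1)]] by (auto simp: P_def less_Suc_eq_le)
  then obtain M where PM: "P M" and max: "\<And>K. P K \<Longrightarrow> card K \<le> card M"
    using ex_has_greatest_nat[of P N card "Suc (card R)"] \<open>P N\<close> by (metis less_imp_le_nat)
  have M: "subgroup M G" "N \<subseteq> M" "M \<subseteq> R" "d \<notin> M" using PM by (auto simp: P_def)
  have Mn: "M \<lhd> G" by (rule normal_if_comm_closed[OF M(1)]) (use comm_R M(2,3) in blast)
  have Rc: "y \<in> carrier G" if "y \<in> R" for y using subgroup.mem_carrier[OF R(1) that] .
  let ?L = "generate G (insert d M)"
  have L: "subgroup ?L G" "M \<subseteq> ?L" "d \<in> ?L" using generate_insert[OF M(1) Rc[OF R(2)]] .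
  have "R \<subseteq> ?L"
  proof
    fix y assume y: "y \<in> R"
    show "y \<in> ?L"
    proof (cases "y \<in> M")
      case False
      let ?K = "generate G (insert y M)"
      have K: "subgroup ?K G" "M \<subseteq> ?K" "y \<in> ?K" using generate_insert[OF M(1) Rc[OF y]] .
      have KR: "?K \<subseteq> R" using generate_insert_least[OF R(1) y M(3)] .
      have "card M < card ?K"
        using K(2,3) False finite_subgroup[OF K(1)] by (intro psubset_card_mono) auto
      then have "\<not> P ?K" using max by (meson not_le)
      then have "d \<in> ?K" using K(1,2) KR M(2) unfolding P_def by blast
      then have "?L \<subseteq> ?K" using generate_insert_least[OF K(1) _ K(2)] by blast
      moreover have "card ?K \<le> p * card M" using card_generate_le[OF Mn Rc[OF y]] pow_R[OF y] M(2) by blast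
      then have "card ?K \<le> card ?L" using card_generate_ge[OF M(1) Rc[OF R(2)] M(4)] by linarith
      ultimately have "?L = ?K" using finite_subgroup[OF K(1)] by (simp add: card_seteq)
      then show ?thesis using K(3) by simp
    qed (use L in blast)
  qed
  then have "card R \<le> card ?L" using finite_subgroup[OF L(1)] card_mono by blast
  also have "\<dots> \<le> p * card M" using card_generate_le[OF Mn Rc[OF R(2)]] pow_R[OF R(2)] M(2) by blast
  finally show ?thesis using that Mn M by blast
qed

text \<open>With \<open>N = ZD\<close> and \<open>d\<close> in \<open>D\<close> outside \<open>ZD\<close>, the centralizer \<open>C\<close> of \<open>D\<close> is that of \<open>d\<close> and has
  index at most \<open>p\<close>. As \<open>[C,C] \<subseteq> ZD\<close>, the elements \<open>x\<close> of \<open>C\<close> with \<open>[x,z] \<in> ZD\<close>, for one \<open>z\<close> outside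
  \<open>C\<close>, already satisfy \<open>[x,G] \<subseteq> ZD\<close>. They form a subgroup \<open>R\<close> of index at most \<open>p\<^sup>2\<close> in which all
  \<open>p\<close>-th powers lie in \<open>ZD\<close>, and a complement to \<open>D\<close> in it modulo \<open>ZD\<close> is the kernel of the required
  quotient.\<close>
lemma prime_square_in_cod_if_center_index_p:
  assumes index: "p * card ZD = card D"
  shows "of_nat (p ^ 2) \<in> cod G"
proof -
  obtain d z where d: "d \<in> D" and z: "z \<in> carrier G" and dz: "comm d z \<noteq> \<one>" using D_noncentral by blast
  have dc: "d \<in> carrier G" using D_carrier d by simp
  have dZ: "d \<notin> ZD" using ZD_central dz z by blast
  have D_gen: "D = generate G (insert d ZD)"
    using eq_generate_insert[OF ZD_subgroup D_subgroup d dZ ZD_le_D] index by simp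
  have "cent_mod {\<one>} {d} \<subseteq> C"
  proof
    fix g assume "g \<in> cent_mod {\<one>} {d}"
    then have g: "g \<in> carrier G" "comm d g = \<one>" using dc comm_eq_one_sym by (auto simp: in_centralizer_iff)
    have "D \<subseteq> cent_mod {\<one>} {g}"
    proof (subst D_gen, rule generate_insert_least)
      show "subgroup (cent_mod {\<one>} {g}) G" using g by (simp add: subgroup_centralizer)
      show "d \<in> cent_mod {\<one>} {g}" using g dc by (simp add: in_centralizer_iff)
      show "ZD \<subseteq> cent_mod {\<one>} {g}"
        using g ZD_central ZD_le_D D_carrier by (auto simp: in_centralizer_iff)
    qed
    then show "g \<in> C" using g(1) D_carrier comm_eq_one_sym by (intro CI) (auto simp: in_centralizer_iff)
  qed
  then have sub: "carrier G \<inter> cent_mod {\<one>} {d} \<subseteq> C" by blast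
  have "Coset.order G \<le> p * card (carrier G \<inter> cent_mod {\<one>} {d})"
    using card_centralizer_le[OF d subgroup_self] by (simp add: Coset.order_def)
  also have "\<dots> \<le> p * card C" using card_mono[OF finite_subgroup[OF C_subgroup] sub] by simp
  finally have G_le: "Coset.order G \<le> p * card C" .
  have zC: "z \<notin> C" using CD[of z d] d dz comm_eq_one_sym z dc by blast
  have G_gen: "carrier G = generate G (insert z C)"
    using eq_generate_insert[OF C_subgroup subgroup_self z zC] G_le C_carrier
    by (auto simp: Coset.order_def)
  define R where "R = C \<inter> cent_mod ZD {z}"
  have R: "subgroup R G" unfolding R_def
    by (intro subgroups_Inter_pair C_subgroup subgroup_cent_mod ZD_normal) (use z in simp)
  have C_le: "card C \<le> p * card R" unfolding R_def
    using comm_D C_carrier z index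
    by (intro card_cent_mod_le[OF fin ZD_normal C_subgroup z D_subgroup ZD_le_D]) auto
  have Rc: "x \<in> carrier G" "x \<in> C" "comm x z \<in> ZD" if "x \<in> R" for x
    using that C_carrier by (auto simp: R_def cent_mod_def)
  have comm_R: "comm x g \<in> ZD" if x: "x \<in> R" and g: "g \<in> carrier G" for x g
  proof -
    have "generate G (insert z C) \<subseteq> cent_mod ZD {x}"
    proof (rule generate_insert_least)
      show "subgroup (cent_mod ZD {x}) G" using Rc(1)[OF x] by (intro subgroup_cent_mod ZD_normal) simp
      show "z \<in> cent_mod ZD {x}"
        using z comm_commute[OF ZD_subgroup Rc(1)[OF x] z Rc(3)[OF x]] by (simp add: cent_mod_def)
      show "C \<subseteq> cent_mod ZD {x}"
        using comm_centralizers_central Rc(2)[OF x] C_carrier by (auto simp: cent_mod_def)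
    qed
    then have "comm g x \<in> ZD" using g G_gen by (auto simp: cent_mod_def)
    then show ?thesis using comm_commute[OF ZD_subgroup g Rc(1)[OF x]] by simp
  qed
  have DR: "D \<subseteq> R" unfolding R_def
    using D_le_C comm_DG z T_le_ZD D_carrier by (auto simp: cent_mod_def)
  have pow_R: "x [^] p \<in> ZD" if x: "x \<in> R" for x
  proof (rule ZDI)
    show "x [^] p \<in> D" using pow_D Rc(1)[OF x] .
    fix g assume g: "g \<in> carrier G"
    show "comm (x [^] p) g = \<one>"
      using comm_pow_both[OF Rc(2)[OF x] g] ZD_central[OF comm_R[OF x g] g] .
  qed
  have "ZD \<subseteq> R" using ZD_le_D DR by blast
  then obtain M where M: "M \<lhd> G" "ZD \<subseteq> M" "d \<notin> M" "card R \<le> p * card M"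
    using exists_complement[OF ZD_subgroup _ dZ R _ comm_R pow_R] DR d by blast
  have "p * card C \<le> p * (p * (p * card M))"
    using C_le M(4) by (meson le_trans mult_le_mono2)
  with G_le have "Coset.order G \<le> p * (p * (p * card M))" by (rule le_trans)
  then have "Coset.order G \<le> p ^ 3 * card M" by (simp only: power3_eq_cube mult.assoc)
  then show ?thesis
    using prime_square_in_cod_if_normal[OF M(1)] M(2,3) d T_le_ZD by blast
qed

end

section \<open>Centre of index p^2 in the derived subgroup\<close>

text \<open>The remaining configuration. The commutator pairing of \<open>D/T\<close> with \<open>G/C\<close> is perfect, both being of
  rank two, and \<open>e\<close> generates \<open>C\<close> modulo \<open>D\<close>.\<close>
locale class3_rank3 = class3_p_group G p D T for G (structure) and p and D and T +
  fixes h1 h2 e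
  assumes h_carrier: "h1 \<in> carrier G" "h2 \<in> carrier G" and eC: "e \<in> C" and eD: "e \<notin> D"
    and gen: "\<And>L. \<lbrakk>subgroup L G; h1 \<in> L; h2 \<in> L; e \<in> L; D \<subseteq> L\<rbrakk> \<Longrightarrow> L = carrier G"
    and ZD_T: "ZD = T" and card_D: "card D = p ^ 3" and order_G: "Coset.order G = p ^ 6"
    and C_index: "p ^ 2 * card C \<le> Coset.order G"
begin

lemma e_carrier: "e \<in> carrier G" using C_carrier eC .

text \<open>Since \<open>[x,D] \<subseteq> T \<subseteq> N\<close> holds anyway, it suffices to know \<open>[x,h1]\<close>, \<open>[x,h2]\<close> and \<open>[x,e]\<close>.\<close>
lemma radical_mod:
  assumes N: "subgroup N G" "T \<subseteq> N" "N \<subseteq> D" and x: "x \<in> carrier G"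
    and L: "subgroup L G" "L \<subseteq> cent_mod N {x}" "h1 \<in> L" "h2 \<in> L" "e \<in> L" and g: "g \<in> carrier G"
  shows "comm x g \<in> N"
proof -
  have "subgroup (cent_mod N {x}) G" using x by (intro subgroup_cent_mod normal_above_T N) simp
  moreover have "D \<subseteq> cent_mod N {x}" using comm_DG x N(2) D_carrier by (auto simp: cent_mod_def)
  ultimately have "cent_mod N {x} = carrier G" using L by (intro gen) auto
  then have "comm g x \<in> N" using g by (auto simp: cent_mod_def)
  then show ?thesis using comm_commute[OF N(1) g x] by simp
qed

lemma maximal_containing:
  assumes c: "c \<in> D"
  obtains N where "subgroup N G" "T \<subseteq> N" "N \<subseteq> D" "p * card N = card D" "c \<in> N"
proof -
  note witness = that
  have *: thesis if c': "c' \<in> D" "c' \<notin> T" and cc: "c = c' \<or> c \<in> T" for c'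
  proof -
    have c'c: "c' \<in> carrier G" using D_carrier c' by simp
    let ?N = "generate G (insert c' T)"
    have "card ?N \<le> p * card T"
      using card_generate_le[OF T_normal c'c] pow_D_central[OF c'(1)] ZD_T by simp
    then have "card ?N = p * p" using card_generate_ge[OF T c'c c'(2)] card_T by simp
    then show ?thesis
      using generate_insert[OF T c'c] generate_insert_least[OF D_subgroup c'(1) TD] cc card_D
      by (intro witness[of ?N]) (auto simp: power3_eq_cube)
  qed
  have "T \<noteq> D"
  proof
    assume "T = D"
    then have "p ^ 1 = p ^ 3" using card_T card_D by simp
    then have "(1::nat) = 3" using p_gt_1 power_inject_exp by blast
    then show False by simp
  qed
  then obtain c' where "c' \<in> D" "c' \<notin> T" using TD by blast
  then show ?thesis using * c by (cases "c \<in> T") blast+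
qed

lemma order_le_D: "Coset.order G \<le> p ^ 3 * card D"
  by (simp add: order_G card_D flip: power_add)

text \<open>Here \<open>e\<close> itself is the radical generator, and \<open>e\<^sup>p \<in> N\<close> has to be shown. The centralizer of \<open>N\<close>
  has index at most \<open>p\<close>, so it contains some \<open>y\<close> outside \<open>C\<close>; then \<open>N\<close> is exactly the centralizer
  of \<open>y\<close> in \<open>D\<close>. As \<open>[e,y] \<in> N\<close> commutes with \<open>y\<close>, so does \<open>e\<^sup>p\<close>.\<close>
lemma prime_square_in_cod_if_e_radical:
  assumes N: "subgroup N G" "T \<subseteq> N" "N \<subseteq> D" "p * card N = card D"
    and e: "\<And>g. g \<in> carrier G \<Longrightarrow> comm e g \<in> N"
  shows "of_nat (p ^ 2) \<in> cod G"
proof -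
  have card_N: "card N = p * card T" using N(4) card_D card_T p_pos by (simp add: power3_eq_cube)
  then have "N \<noteq> T" using card_T p_gt_1 by auto
  then obtain n where n: "n \<in> N" "n \<notin> T" using N(2) by blast
  have nD: "n \<in> D" using n N(3) by blast
  have nc: "n \<in> carrier G" using D_carrier nD .
  have N_gen: "N = generate G (insert n T)"
    using eq_generate_insert[OF T N(1) n N(2)] card_N by simp
  have "\<not> cent_mod {\<one>} {n} \<subseteq> C"
  proof
    assume "cent_mod {\<one>} {n} \<subseteq> C"
    then have sub: "carrier G \<inter> cent_mod {\<one>} {n} \<subseteq> C" by blast
    have "p ^ 2 * card C \<le> p * card (carrier G \<inter> cent_mod {\<one>} {n})"
      using card_centralizer_le[OF nD subgroup_self] C_index by (simp add: Coset.order_def)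
    also have "\<dots> \<le> p * card C" using card_mono[OF finite_subgroup[OF C_subgroup] sub] by simp
    finally have "p * (p * card C) \<le> p * card C" by (simp only: power2_eq_square mult.assoc)
    then have "p * card C \<le> 1 * card C" using p_pos by simp
    moreover have "card C > 0"
      using finite_subgroup[OF C_subgroup] subgroup.one_closed[OF C_subgroup] by (auto simp: card_gt_0_iff)
    ultimately show False using p_gt_1 by (simp only: mult_le_cancel2) simp
  qed
  then obtain y where "y \<in> cent_mod {\<one>} {n}" and yC: "y \<notin> C" by blast
  then have y: "y \<in> carrier G" "comm y n = \<one>" "y \<notin> C" using nc by (simp_all add: in_centralizer_iff)
  \<comment> \<open>\<open>N\<close> has index \<open>p\<close> in \<open>D\<close>, and \<open>Dy\<close> lies between them, properly below \<open>D\<close> as \<open>y\<close> is not in \<open>C\<close>.\<close>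
  define Dy where "Dy = D \<inter> cent_mod {\<one>} {y}"
  have Dy: "subgroup Dy G" unfolding Dy_def
    by (intro subgroups_Inter_pair D_subgroup subgroup_centralizer) (use y in simp)
  have NDy: "N \<subseteq> Dy" unfolding N_gen
  proof (rule generate_insert_least[OF Dy])
    show "n \<in> Dy" using nD nc y comm_eq_one_sym by (simp add: Dy_def in_centralizer_iff)
    show "T \<subseteq> Dy" using TD T_central T_carrier y by (auto simp: Dy_def in_centralizer_iff)
  qed
  have "Dy \<subset> D"
  proof
    show "Dy \<noteq> D"
    proof
      assume "Dy = D"
      then have "y \<in> C" using y comm_eq_one_sym D_carrier by (intro CI) (auto simp: Dy_def in_centralizer_iff)
      then show False using y by simp
    qed
  qed (simp add: Dy_def)
  then have "card Dy < p * card N" using psubset_card_mono[OF finite_subgroup[OF D_subgroup]] N(4) by simp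
  then have "N = Dy" using subgroup_eqI[OF N(1) Dy NDy] by simp
  moreover have "comm (e [^] p) y = \<one>"
  proof (rule comm_pow_both[OF eC y(1)])
    have "comm e y \<in> Dy" using e y NDy by blast
    then show "comm (comm e y) y = \<one>" using y by (simp add: Dy_def in_centralizer_iff)
  qed
  then have "e [^] p \<in> Dy" using pow_D e_carrier y by (simp add: Dy_def in_centralizer_iff)
  ultimately have "e [^] p \<in> N" by simp
  then show ?thesis
    using prime_square_in_cod_if_radical_generator[OF N order_le_D e_carrier eD] e by simp
qed

text \<open>If some \<open>N\<close> contains \<open>[e,G]\<close>, the previous lemma applies. Otherwise \<open>n = [e,h1]\<close> and \<open>m = [e,h2]\<close>
  are independent in \<open>D/T\<close>. Put \<open>N = \<langle>n\<rangle>T\<close>. Multiplying \<open>h1\<close> by a power of \<open>e\<close> yields \<open>x\<close> with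
  \<open>[x,h2] \<in> N\<close>, hence \<open>[x,G] \<subseteq> N\<close>; multiplying \<open>h2\<close> by a power of \<open>e\<close> yields \<open>y\<close> with \<open>[x,y] \<in> T\<close>.
  Then \<open>[x\<^sup>p,y] = [x,y]\<^sup>p = 1\<close>, so \<open>x\<^sup>p\<close> commutes with \<open>x\<close>, \<open>y\<close>, \<open>e\<close> and \<open>D\<close>, is central, and lies in
  \<open>T\<close>.\<close>
lemma prime_square_in_cod: "of_nat (p ^ 2) \<in> cod G"
proof (rule ccontr)
  assume contra: "of_nat (p ^ 2) \<notin> cod G"
  have not_radical: False
    if N: "subgroup N G" "T \<subseteq> N" "N \<subseteq> D" "p * card N = card D" and "comm e h1 \<in> N" "comm e h2 \<in> N" for N
  proof -
    have "subgroup (cent_mod N {e}) G" using e_carrier by (intro subgroup_cent_mod normal_above_T N) simp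
    moreover have "comm h1 e \<in> N" "comm h2 e \<in> N"
      using comm_commute[OF N(1) e_carrier] h_carrier that by auto
    ultimately have "comm e g \<in> N" if "g \<in> carrier G" for g
      using that h_carrier e_carrier subgroup.one_closed[OF N(1)]
      by (intro radical_mod[OF N(1-3) e_carrier, of "cent_mod N {e}"]) (auto simp: cent_mod_def)
    then show False using prime_square_in_cod_if_e_radical[OF N] contra by blast
  qed
  define n m where "n = comm e h1" and "m = comm e h2"
  have nm: "n \<in> D" "m \<in> D" using comm_D e_carrier h_carrier by (simp_all add: n_def m_def)
  have nmc: "n \<in> carrier G" "m \<in> carrier G" using nm D_carrier by auto
  have nT: "n \<notin> T"
  proof
    assume "n \<in> T"
    moreover obtain N where "subgroup N G" "T \<subseteq> N" "N \<subseteq> D" "p * card N = card D" "m \<in> N"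
      using maximal_containing[OF nm(2)] .
    ultimately show False using not_radical[of N] by (auto simp: n_def m_def)
  qed
  define N where "N = generate G (insert n T)"
  have N: "subgroup N G" "T \<subseteq> N" "n \<in> N" using generate_insert[OF T nmc(1)] by (simp_all add: N_def)
  have ND: "N \<subseteq> D" unfolding N_def by (rule generate_insert_least[OF D_subgroup nm(1) TD])
  have npT: "n [^] p \<in> T" "m [^] p \<in> T" using pow_D_central nm ZD_T by simp_all
  have "card N \<le> p * card T" unfolding N_def by (rule card_generate_le[OF T_normal nmc(1) npT(1)])
  then have card_N: "p * card N = card D"
    using card_generate_ge[OF T nmc(1) nT] card_T card_D by (simp add: N_def power3_eq_cube)
  have Nn: "N \<lhd> G" using normal_above_T N ND by simp
  have mN: "m \<notin> N" using not_radical[OF N(1,2) ND card_N] N(3) by (auto simp: n_def m_def)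
  have D_gen: "D = generate G (insert m N)"
    using eq_generate_insert[OF N(1) D_subgroup nm(2) mN ND] card_N by simp
  have D_comm: "a \<otimes> b = b \<otimes> a" if "a \<in> D" "b \<in> D" for a b
    using D_abelian[OF that] comm_eq_one_iff D_carrier that by simp
  have e_comm: "e \<otimes> d = d \<otimes> e" if "d \<in> D" for d
    using CD[OF eC that] comm_eq_one_iff D_carrier that e_carrier by simp
  \<comment> \<open>The exponent \<open>s\<close> is read off from \<open>[h1,h2]\<close>, written in terms of \<open>m = [e,h2]\<close> modulo \<open>N\<close>.\<close>
  define c where "c = comm h1 h2"
  have c: "c \<in> D" "c \<in> carrier G" using comm_D h_carrier by (simp_all add: c_def)
  have "inv c \<in> generate G (insert m N)" using subgroup.m_inv_closed[OF D_subgroup c(1)] D_gen by simp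
  then obtain s n' where s: "n' \<in> N" "inv c = m [^] (s::nat) \<otimes> n'"
    using generate_insert_normal[OF Nn nmc(2) _ p_pos] npT(2) N(2) by blast
  have n'D: "n' \<in> D" using s ND by blast
  then have n'c: "n' \<in> carrier G" using D_carrier by simp
  have msD: "m [^] s \<in> D" using subgroup_pow_closed[OF D_subgroup nm(2)] .
  define x where "x = h1 \<otimes> e [^] s"
  have x: "x \<in> carrier G" using h_carrier e_carrier by (simp add: x_def)
  have "comm (e [^] s) h2 = m [^] s" unfolding m_def
    by (rule comm_pow_left[OF e_carrier h_carrier(2)]) (use e_comm[OF nm(2)] in \<open>simp add: m_def\<close>)
  then have "comm x h2 = h1 \<otimes> m [^] s \<otimes> inv h1 \<otimes> c"
    using h_carrier e_carrier by (simp add: x_def c_def comm_mult_left)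
  also have "\<dots> = comm h1 (m [^] s) \<otimes> (m [^] s \<otimes> c)"
    unfolding conj_eq_comm_mult[OF h_carrier(1) nat_pow_closed[OF nmc(2)]]
    using h_carrier nmc c by (simp add: m_assoc)
  also have "m [^] s \<otimes> c = inv n'"
  proof -
    have "m [^] s = inv c \<otimes> inv n'" using s nmc c n'c by (simp add: m_assoc)
    then have "m [^] s \<otimes> c = c \<otimes> (inv c \<otimes> inv n')" using D_comm[OF msD c(1)] by simp
    then show ?thesis using c n'c by (simp add: mult_inv_cancel)
  qed
  finally have xh2: "comm x h2 \<in> N"
    using subgroup.m_closed[OF N(1)] subgroup.m_inv_closed[OF N(1) s(1)] comm_GD[OF h_carrier(1) msD] N(2) by auto
  have "comm (e [^] s) e = \<one>" using e_carrier comm_pow_left[OF e_carrier e_carrier, of s] by simp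
  then have xe: "comm x e = inv n"
    using h_carrier e_carrier by (simp add: x_def comm_mult_left comm_inv n_def)
  have xeN: "comm x e \<in> N" using xe subgroup.m_inv_closed[OF N(1,3)] by simp
  have cx: "subgroup (cent_mod N {x}) G" using x by (intro subgroup_cent_mod Nn) simp
  have e_cx: "e \<in> cent_mod N {x}" using comm_commute[OF N(1) x e_carrier xeN] e_carrier by (simp add: cent_mod_def)
  have x_cx: "x \<in> cent_mod N {x}" using x subgroup.one_closed[OF N(1)] by (simp add: cent_mod_def)
  have h1_eq: "h1 = x \<otimes> inv (e [^] s)" using h_carrier e_carrier by (simp add: x_def m_assoc)
  have h1_cx: "h1 \<in> cent_mod N {x}" unfolding h1_eq
    by (intro subgroup.m_closed[OF cx] x_cx subgroup.m_inv_closed[OF cx] subgroup_pow_closed[OF cx] e_cx)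
  have h2_cx: "h2 \<in> cent_mod N {x}"
    using comm_commute[OF N(1) x h_carrier(2) xh2] h_carrier by (simp add: cent_mod_def)
  have xN: "comm x g \<in> N" if "g \<in> carrier G" for g
    using radical_mod[OF N(1,2) ND x cx _ h1_cx h2_cx e_cx that] by simp
  \<comment> \<open>Likewise \<open>k\<close> is read off from \<open>[x,h2]\<close>, a power of \<open>n = [e,x]\<close> modulo \<open>T\<close>.\<close>
  obtain k t where k: "t \<in> T" "comm x h2 = n [^] (k::nat) \<otimes> t"
    using generate_insert_normal[OF T_normal nmc(1) npT(1) p_pos] xh2 unfolding N_def by blast
  have tc: "t \<in> carrier G" using T_carrier k by simp
  define y where "y = h2 \<otimes> e [^] k"
  have y: "y \<in> carrier G" using h_carrier e_carrier by (simp add: y_def)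
  have ex: "comm e x = n" using comm_inv[OF x e_carrier] xe nmc by simp
  have nkD: "n [^] k \<in> D" using subgroup_pow_closed[OF D_subgroup nm(1)] .
  have "comm (e [^] k) x = n [^] k"
    using comm_pow_left[OF e_carrier x, of k] ex e_comm[OF nm(1)] by simp
  moreover have "comm h2 x = inv (n [^] k \<otimes> t)" using comm_inv[OF x h_carrier(2)] k by simp
  ultimately have "comm y x = h2 \<otimes> n [^] k \<otimes> inv h2 \<otimes> inv (n [^] k \<otimes> t)"
    using h_carrier e_carrier x by (simp add: y_def comm_mult_left)
  also have "\<dots> = comm h2 (n [^] k) \<otimes> (n [^] k \<otimes> inv (n [^] k \<otimes> t))"
    unfolding conj_eq_comm_mult[OF h_carrier(2) nat_pow_closed[OF nmc(1)]]
    using h_carrier nmc tc by (simp add: m_assoc)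
  also have "n [^] k \<otimes> inv (n [^] k \<otimes> t) = inv t"
  proof -
    have "inv (n [^] k \<otimes> t) = inv (n [^] k) \<otimes> inv t"
      using D_comm[OF nkD, of t] k TD nmc tc by (auto simp: inv_mult_group[symmetric])
    then show ?thesis using nmc tc by (simp add: mult_inv_cancel)
  qed
  finally have "comm y x \<in> T"
    using subgroup.m_closed[OF T comm_GD[OF h_carrier(2) nkD] subgroup.m_inv_closed[OF T k(1)]] by simp
  then have xy: "comm x y \<in> T" using comm_commute[OF T y x] by simp
  have xpD: "x [^] p \<in> D" using pow_D x by simp
  have xpc: "x [^] p \<in> carrier G" using x by simp
  have cp: "subgroup (cent_mod {\<one>} {x [^] p}) G" using x by (simp add: subgroup_centralizer)
  have x_cp: "x \<in> cent_mod {\<one>} {x [^] p}"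
    using x comm_pow_left[OF x x, of p] comm_eq_one_sym[OF x xpc] by (simp add: in_centralizer_iff)
  have y_cp: "y \<in> cent_mod {\<one>} {x [^] p}"
    using comm_pow_in_T[OF x y xy] comm_eq_one_sym[OF y xpc] y xpc by (simp add: in_centralizer_iff)
  have e_cp: "e \<in> cent_mod {\<one>} {x [^] p}" using CD[OF eC xpD] e_carrier xpc by (simp add: in_centralizer_iff)
  have h2_eq: "h2 = y \<otimes> inv (e [^] k)" using h_carrier e_carrier by (simp add: y_def m_assoc)
  have "cent_mod {\<one>} {x [^] p} = carrier G"
  proof (rule gen[OF cp _ _ e_cp])
    show "h1 \<in> cent_mod {\<one>} {x [^] p}" unfolding h1_eq
      by (intro subgroup.m_closed[OF cp] x_cp subgroup.m_inv_closed[OF cp] subgroup_pow_closed[OF cp] e_cp)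
    show "h2 \<in> cent_mod {\<one>} {x [^] p}" unfolding h2_eq
      by (intro subgroup.m_closed[OF cp] y_cp subgroup.m_inv_closed[OF cp] subgroup_pow_closed[OF cp] e_cp)
    show "D \<subseteq> cent_mod {\<one>} {x [^] p}" using D_abelian[OF _ xpD] D_carrier xpc by (auto simp: in_centralizer_iff)
  qed
  then have "comm (x [^] p) g = \<one>" if "g \<in> carrier G" for g
    using that comm_eq_one_sym[OF xpc that] xpc by (metis in_centralizer_iff)
  then have "x [^] p \<in> N" using ZDI[OF xpD] ZD_T N(2) by blast
  moreover have "x \<notin> D"
  proof
    assume "x \<in> D"
    then have "comm x e = \<one>" using CD[OF eC] comm_eq_one_sym[OF e_carrier x] by simp
    then have "n = \<one>" using xe nmc by simp
    then show False using nT one_T by simp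
  qed
  ultimately have "of_nat (p ^ 2) \<in> cod G"
    using prime_square_in_cod_if_radical_generator[OF N(1,2) ND card_N order_le_D x] xN by blast
  then show False using contra by contradiction
qed

end

context class3_p_group
begin

text \<open>Two elements \<open>h1\<close>, \<open>h2\<close> with \<open>D > C\<^sub>D(h1) > C\<^sub>D(h1,h2)\<close> exist, which gives \<open>|D| \<ge> p\<^sup>3\<close> and
  \<open>|G : C| \<ge> p\<^sup>2\<close>. On the other hand \<open>|G : D| \<ge> p\<^sup>3\<close>: otherwise \<open>C = D\<close>, and \<open>G\<close> is generated by \<open>h1\<close>,
  \<open>h2\<close> and \<open>D\<close>, so that \<open>D\<close> is generated modulo \<open>ZD\<close> by the single commutator \<open>[h1,h2]\<close> and \<open>|D : ZD|\<close>
  is too small. Since \<open>|G| \<le> p\<^sup>6\<close>, all these inequalities are equalities.\<close>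
lemma prime_square_in_cod_if_center_index_large:
  assumes index: "p * card ZD \<noteq> card D"
  shows "of_nat (p ^ 2) \<in> cod G"
proof -
  have card_pos: "card K > 0" if "subgroup K G" for K
    using finite_subgroup[OF that] subgroup.one_closed[OF that] card_gt_0_iff by blast
  obtain a h1 where a: "a \<in> D" and h1: "h1 \<in> carrier G" "comm a h1 \<noteq> \<one>" using D_noncentral by blast
  define D1 where "D1 = D \<inter> cent_mod {\<one>} {h1}"
  have D1: "subgroup D1 G" unfolding D1_def
    by (intro subgroups_Inter_pair D_subgroup subgroup_centralizer) (use h1 in simp)
  have D1D: "D1 \<subset> D" using a h1 by (auto simp: D1_def cent_mod_def)
  have cD1: "card D = p * card D1"
    using card_centralizer_in_D_le[OF h1(1) D_subgroup] subgroup_index[OF D1 D_subgroup D1D]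
    unfolding D1_def by simp
  have "ZD \<subseteq> D1" using ZD_le_D ZD_central h1(1) D_carrier by (auto simp: D1_def cent_mod_def)
  moreover have "ZD \<noteq> D1" using index cD1 by auto
  ultimately have ZD1: "ZD \<subset> D1" by blast
  then obtain d2 where d2: "d2 \<in> D1" "d2 \<notin> ZD" by blast
  have d2D: "d2 \<in> D" using d2 D1D by blast
  obtain h2 where h2: "h2 \<in> carrier G" "comm d2 h2 \<noteq> \<one>" using ZDI[OF d2D] d2(2) by blast
  define D2 where "D2 = D1 \<inter> cent_mod {\<one>} {h2}"
  have D2: "subgroup D2 G" unfolding D2_def
    by (intro subgroups_Inter_pair D1 subgroup_centralizer) (use h2 in simp)
  have D2D1: "D2 \<subset> D1" using d2 h2 by (auto simp: D2_def cent_mod_def)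
  have cD2: "card D1 = p * card D2"
    using card_centralizer_in_D_le[OF h2(1) D1] D1D subgroup_index[OF D2 D1 D2D1]
    unfolding D2_def by (simp add: psubset_imp_subset)
  have ZD2: "ZD \<subseteq> D2" using ZD1 ZD_central h2(1) ZD_le_D D_carrier by (auto simp: D2_def cent_mod_def)
  have TD2: "T \<subseteq> D2" using T_le_ZD ZD2 by blast
  have "p \<le> card D2" using card_mono[OF finite_subgroup[OF D2] TD2] card_T by simp
  then have D_ge: "p ^ 3 \<le> card D" using cD1 cD2 by (simp add: power3_eq_cube)
  \<comment> \<open>The centralizer of \<open>D1\<close> lies strictly between \<open>C\<close> and \<open>G\<close>: it contains \<open>h1\<close> but not \<open>h2\<close>.\<close>
  define CD1 where "CD1 = cent_mod {\<one>} D1"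
  have D1c: "D1 \<subseteq> carrier G" using subgroup.subset[OF D1] .
  have CD1: "subgroup CD1 G" unfolding CD1_def by (rule subgroup_centralizer[OF D1c])
  have C_CD1: "C \<subseteq> CD1" using D1D by (auto simp: C_def CD1_def cent_mod_def)
  have h1_CD1: "h1 \<in> CD1"
    using h1(1) D1c comm_eq_one_sym[of h1] by (auto simp: CD1_def D1_def cent_mod_def)
  have h1C: "h1 \<notin> C"
    using CD[OF _ a, of h1] comm_eq_one_sym[OF h1(1) D_carrier[OF a]] h1(2) by blast
  have h2_CD1: "h2 \<notin> CD1"
    using d2(1) h2 comm_eq_one_sym[OF h2(1) D_carrier[OF d2D]] by (auto simp: CD1_def cent_mod_def)
  have "C \<subset> CD1" using C_CD1 h1_CD1 h1C by blast
  then have "p * card C \<le> card CD1" using subgroup_index[OF C_subgroup CD1] by simp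
  moreover have "CD1 \<subset> carrier G" using subgroup.subset[OF CD1] h2(1) h2_CD1 by blast
  then have "p * card CD1 \<le> Coset.order G"
    using subgroup_index[OF CD1 subgroup_self] by (simp add: Coset.order_def)
  ultimately have C_index: "p ^ 2 * card C \<le> Coset.order G"
    by (metis le_trans mult.assoc mult_le_mono2 power2_eq_square)
  have gen_C: "L = carrier G"
    if le: "Coset.order G \<le> p ^ 2 * card C" and L: "subgroup L G" "h1 \<in> L" "h2 \<in> L" "C \<subseteq> L" for L
  proof -
    have "L \<inter> CD1 \<subset> L" using L(3) h2_CD1 by blast
    then have "p * card (L \<inter> CD1) \<le> card L" using subgroup_index[OF subgroups_Inter_pair[OF L(1) CD1] L(1)] by simp
    moreover have "C \<subset> L \<inter> CD1" using L h1_CD1 h1C C_CD1 by blast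
    then have "p * card C \<le> card (L \<inter> CD1)"
      using subgroup_index[OF C_subgroup subgroups_Inter_pair[OF L(1) CD1]] by simp
    ultimately have "p ^ 2 * card C \<le> card L"
      by (metis le_trans mult.assoc mult_le_mono2 power2_eq_square)
    then have "card (carrier G) \<le> card L" using le by (simp add: Coset.order_def)
    then show ?thesis using subgroup.subset[OF L(1)] fin by (simp add: card_seteq)
  qed
  have order_ge: "p ^ 3 * card D \<le> Coset.order G"
  proof (rule ccontr)
    assume "\<not> p ^ 3 * card D \<le> Coset.order G"
    moreover obtain i j where ij: "Coset.order G = p ^ i" "card D = p ^ j" using ord subgroup_card[OF D_subgroup] by blast
    ultimately have "p ^ i < p ^ (3 + j)" by (simp add: power_add)
    then have "i < 3 + j" using p_gt_1 power_less_imp_less_exp by blast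
    then have "p ^ i \<le> p ^ (2 + j)" using p_gt_1 by (intro power_increasing) auto
    then have le_D: "Coset.order G \<le> p ^ 2 * card D" using ij by (simp only: power_add)
    then have "p ^ 2 * card C \<le> p ^ 2 * card D" using C_index by linarith
    then have "card C \<le> card D" by simp
    then have CD_eq: "C = D" using D_le_C card_seteq[OF finite_subgroup[OF C_subgroup]] by blast
    define c where "c = comm h1 h2"
    have c: "c \<in> D" "c \<in> carrier G" using comm_D h1 h2 by (simp_all add: c_def)
    \<comment> \<open>Modulo \<open>N\<close> the generators \<open>h1\<close> and \<open>h2\<close> commute, so \<open>G/N\<close> is abelian.\<close>
    define N where "N = generate G (insert c ZD)"
    have N: "subgroup N G" "ZD \<subseteq> N" "c \<in> N" using generate_insert[OF ZD_subgroup c(2)] by (simp_all add: N_def)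
    have ND: "N \<subseteq> D" unfolding N_def by (rule generate_insert_least[OF D_subgroup c(1) ZD_le_D])
    have TN: "T \<subseteq> N" using T_le_ZD N(2) by blast
    have Nn: "N \<lhd> G" using normal_above_T[OF N(1) TN ND] .
    have all: "cent_mod N {g} = carrier G"
      if g: "g \<in> carrier G" and "comm h1 g \<in> N" "comm h2 g \<in> N" for g
    proof (rule gen_C)
      show "Coset.order G \<le> p ^ 2 * card C" using le_D CD_eq by simp
      show "subgroup (cent_mod N {g}) G" using g by (intro subgroup_cent_mod Nn) simp
      show "h1 \<in> cent_mod N {g}" "h2 \<in> cent_mod N {g}" using that h1 h2 by (simp_all add: cent_mod_def)
      show "C \<subseteq> cent_mod N {g}" unfolding CD_eq using comm_DG g TN D_carrier by (auto simp: cent_mod_def)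
    qed
    have c': "comm h2 h1 \<in> N" using comm_commute[OF N(1) h1(1) h2(1)] N(3) by (simp add: c_def)
    have "comm g h1 \<in> N" "comm g h2 \<in> N" if g: "g \<in> carrier G" for g
      using all[OF h1(1)] all[OF h2(1)] c' N(3) subgroup.one_closed[OF N(1)] h1 h2 g
      by (auto simp: cent_mod_def c_def)
    then have "comm h1 g \<in> N" "comm h2 g \<in> N" if g: "g \<in> carrier G" for g
      using comm_commute[OF N(1) g] h1 h2 g by auto
    then have "comm x y \<in> N" if "x \<in> carrier G" "y \<in> carrier G" for x y
      using all[OF that(2)] that by (auto simp: cent_mod_def)
    then have "D \<subseteq> N" unfolding D_def by (intro derived_least N(1))
    then have "card D \<le> card N" using card_mono[OF finite_subgroup[OF N(1)]] by simp
    also have "\<dots> \<le> p * card ZD"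
      unfolding N_def by (rule card_generate_le[OF ZD_normal c(2) pow_D_central[OF c(1)]])
    also have "\<dots> \<le> card D1" using subgroup_index[OF ZD_subgroup D1 ZD1] .
    also have "\<dots> < card D" using psubset_card_mono[OF finite_subgroup[OF D_subgroup] D1D] .
    finally show False by simp
  qed
  then have "p ^ 3 * card D \<le> p ^ 3 * p ^ 3" using order_le by (simp flip: power_add)
  then have "card D \<le> p ^ 3" by (rule mult_left_le_imp_le) simp
  then have card_D: "card D = p ^ 3" using D_ge by simp
  then have order_G: "Coset.order G = p ^ 6" using order_ge order_le by (simp flip: power_add)
  have "card D2 = p" using card_D cD1 cD2 p_gt_1 by (auto simp: power3_eq_cube)
  then have D2T: "D2 = T" using card_seteq[OF finite_subgroup[OF D2] TD2] card_T by simp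
  then have ZD_T: "ZD = T" using ZD2 T_le_ZD by blast
  have cardD1: "card D1 = p * card T" using cD2 D2T by simp
  obtain d1 where d1: "d1 \<in> D" "d1 \<notin> D1" using D1D by blast
  have dc: "d1 \<in> carrier G" "d2 \<in> carrier G" using d1 d2D D_carrier by auto
  have D1_gen: "D1 = generate G (insert d2 T)"
    using eq_generate_insert[OF T D1 d2(1)] d2(2) ZD_T T_le_ZD ZD1 cardD1 by auto
  have D_gen: "D = generate G (insert d1 D1)"
    using eq_generate_insert[OF D1 D_subgroup d1] D1D cD1 by auto
  let ?C1 = "carrier G \<inter> cent_mod {\<one>} {d1}"
  let ?C12 = "?C1 \<inter> cent_mod {\<one>} {d2}"
  have C1: "subgroup ?C1 G"
    by (intro subgroups_Inter_pair subgroup_self subgroup_centralizer) (use dc in simp)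
  have "?C12 \<subseteq> C"
  proof
    fix g assume "g \<in> ?C12"
    then have g: "g \<in> carrier G" "comm d1 g = \<one>" "comm d2 g = \<one>"
      using dc comm_eq_one_sym by (auto simp: in_centralizer_iff)
    have sub: "subgroup (cent_mod {\<one>} {g}) G" using g by (simp add: subgroup_centralizer)
    have "D1 \<subseteq> cent_mod {\<one>} {g}" unfolding D1_gen
      by (rule generate_insert_least[OF sub])
        (use g dc T_central T_carrier in \<open>auto simp: in_centralizer_iff\<close>)
    then have "D \<subseteq> cent_mod {\<one>} {g}" unfolding D_gen
      by (intro generate_insert_least[OF sub]) (use g dc in \<open>auto simp: in_centralizer_iff\<close>)
    then show "g \<in> C" using g(1) D_carrier comm_eq_one_sym by (intro CI) (auto simp: in_centralizer_iff)
  qed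
  then have "card ?C12 \<le> card C" by (rule card_mono[OF finite_subgroup[OF C_subgroup]])
  moreover have "Coset.order G \<le> p * card ?C1"
    using card_centralizer_le[OF d1(1) subgroup_self] by (simp add: Coset.order_def)
  moreover have "card ?C1 \<le> p * card ?C12" by (rule card_centralizer_le[OF d2D C1])
  ultimately have order_le_C: "Coset.order G \<le> p ^ 2 * card C"
    by (metis (no_types, opaque_lifting) le_trans mult.assoc mult_le_mono2 power2_eq_square)
  then have "p ^ 2 * card C = p ^ 6" using C_index order_G by simp
  also have "\<dots> = p ^ 2 * (p * card D)" unfolding card_D by (simp add: eval_nat_numeral)
  finally have card_C: "card C = p * card D" using p_gt_1 by simp
  have "C \<noteq> D" using card_C card_pos[OF D_subgroup] p_gt_1 by auto
  then obtain e where e: "e \<in> C" "e \<notin> D" using D_le_C by blast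
  have C_gen: "C = generate G (insert e D)"
    using eq_generate_insert[OF D_subgroup C_subgroup e D_le_C] card_C by simp
  interpret class3_rank3 G p D T h1 h2 e
  proof (intro class3_rank3.intro class3_rank3_axioms.intro)
    show "class3_p_group G p D T" by (rule class3_p_group_axioms)
    fix L assume L: "subgroup L G" "h1 \<in> L" "h2 \<in> L" "e \<in> L" "D \<subseteq> L"
    then show "L = carrier G"
      using gen_C[OF order_le_C L(1-3)] generate_insert_least[OF L(1,4,5)] C_gen by simp
  qed (use h1 h2 e ZD_T card_D order_G C_index in simp_all)
  show ?thesis by (rule prime_square_in_cod)
qed

theorem class3_prime_square_in_cod: "of_nat (p ^ 2) \<in> cod G"
  using prime_square_in_cod_if_center_index_p prime_square_in_cod_if_center_index_large by blast

end

section \<open>The lower central series of a p-group\<close>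

context group
begin

lemma commutator_subgroup_eq:
  "commutator_subgroup G H K = generate G {comm h k | h k. h \<in> H \<and> k \<in> K}"
  unfolding commutator_subgroup_def comm_def by (rule arg_cong[of _ _ "generate G"]) auto

lemma commutator_subgroup_least:
  assumes "subgroup S G" "\<And>h k. \<lbrakk>h \<in> H; k \<in> K\<rbrakk> \<Longrightarrow> comm h k \<in> S"
  shows "commutator_subgroup G H K \<subseteq> S"
  unfolding commutator_subgroup_eq using assms(2) by (intro generate_subgroup_incl[OF _ assms(1)]) auto

lemma comm_in_commutator_subgroup: "\<lbrakk>h \<in> H; k \<in> K\<rbrakk> \<Longrightarrow> comm h k \<in> commutator_subgroup G H K"
  unfolding commutator_subgroup_eq by (rule generate.incl) blast

lemma normal_comm_closed:
  assumes "N \<lhd> G" "n \<in> N" "g \<in> carrier G"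
  shows "comm n g \<in> N"
proof -
  have N: "subgroup N G" using normal_imp_subgroup[OF assms(1)] .
  have nc: "n \<in> carrier G" using subgroup.mem_carrier[OF N assms(2)] .
  have "g \<otimes> inv n \<otimes> inv g \<in> N"
    using normal.inv_op_closed2[OF assms(1,3) subgroup.m_inv_closed[OF N assms(2)]] .
  then have "n \<otimes> (g \<otimes> inv n \<otimes> inv g) \<in> N" using subgroup.m_closed[OF N assms(2)] by simp
  then show ?thesis using nc assms(3) by (simp add: comm_def m_assoc)
qed

lemma commutator_subgroup_normal:
  assumes N: "N \<lhd> G"
  shows "commutator_subgroup G N (carrier G) \<subseteq> N" "commutator_subgroup G N (carrier G) \<lhd> G"
proof -
  let ?C = "commutator_subgroup G N (carrier G)"
  have Ns: "subgroup N G" using normal_imp_subgroup[OF N] .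
  show CN: "?C \<subseteq> N" using normal_comm_closed[OF N] by (intro commutator_subgroup_least[OF Ns])
  have "subgroup ?C G" unfolding commutator_subgroup_eq
    by (rule generate_is_subgroup) (use subgroup.mem_carrier[OF Ns] in auto)
  then show "?C \<lhd> G"
    by (rule normal_if_comm_closed) (use CN comm_in_commutator_subgroup in blast)
qed

lemma lower_central_normal: "lower_central G i \<lhd> G"
  by (induction i) (simp_all add: normal_self commutator_subgroup_normal)

lemma lower_central_subgroup: "subgroup (lower_central G i) G"
  using normal_imp_subgroup[OF lower_central_normal] .

lemma lower_central_Suc_subset: "lower_central G (Suc i) \<subseteq> lower_central G i"
  using commutator_subgroup_normal(1)[OF lower_central_normal] by simp

lemma comm_in_lower_central:
  "\<lbrakk>x \<in> lower_central G i; g \<in> carrier G\<rbrakk> \<Longrightarrow> comm x g \<in> lower_central G (Suc i)"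
  by (simp add: comm_in_commutator_subgroup)

lemma lower_central_1: "lower_central G (Suc 0) = derived G (carrier G)"
  by (simp add: commutator_subgroup_def derived_def)

end

context p_group
begin

text \<open>Conjugacy classes have \<open>p\<close>-power size. If no element of \<open>X\<close> but \<open>\<one>\<close> were central, \<open>p\<close> would divide
  both \<open>|X|\<close> and \<open>|X| - 1\<close>.\<close>
lemma normal_meets_center:
  assumes X: "X \<lhd> G" "X \<noteq> {\<one>}"
  obtains z where "z \<in> X" "z \<noteq> \<one>" "\<And>g. g \<in> carrier G \<Longrightarrow> comm z g = \<one>"
proof (rule ccontr)
  assume none: "\<not> thesis"
  have Xs: "subgroup X G" using normal_imp_subgroup[OF X(1)] .
  have Xc: "x \<in> carrier G" if "x \<in> X" for x using subgroup.mem_carrier[OF Xs that] .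
  have finX: "finite X" using finite_subgroup[OF Xs] .
  let ?\<phi> = "\<lambda>g. \<lambda>h\<in>carrier G. g \<otimes> h \<otimes> inv g"
  interpret act: group_action G "carrier G" ?\<phi> by (rule action_by_conjugation)
  let ?orb = "orbit G ?\<phi>"
  have orb: "?orb x = {g \<otimes> x \<otimes> inv g | g. g \<in> carrier G}" if "x \<in> carrier G" for x
    using that by (simp add: orbit_def)
  have orb_self: "x \<in> ?orb x" if "x \<in> carrier G" for x using act.orbit_refl[OF that] .
  have sub: "?orb x \<subseteq> X - {\<one>}" if x: "x \<in> X - {\<one>}" for x
  proof
    fix y assume "y \<in> ?orb x"
    then obtain g where g: "g \<in> carrier G" "y = g \<otimes> x \<otimes> inv g" using orb[of x] x Xc by auto
    have "y \<in> X" using normal.inv_op_closed2[OF X(1) g(1)] x g(2) by simp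
    moreover have "y \<noteq> \<one>"
    proof
      assume "y = \<one>"
      then have "inv g \<otimes> (g \<otimes> x \<otimes> inv g) \<otimes> g = inv g \<otimes> \<one> \<otimes> g" using g(2) by simp
      then show False using g(1) x Xc by (simp add: word_simps)
    qed
    ultimately show "y \<in> X - {\<one>}" by simp
  qed
  have "p dvd card (\<Union> (?orb ` (X - {\<one>})))"
  proof (rule dvd_partition)
    have "\<Union> (?orb ` (X - {\<one>})) \<subseteq> X" using sub by blast
    then show "finite (\<Union> (?orb ` (X - {\<one>})))" using finX by (rule finite_subset)
    show "\<forall>c\<in>?orb ` (X - {\<one>}). p dvd card c"
    proof
      fix c assume "c \<in> ?orb ` (X - {\<one>})"
      then obtain x where x: "x \<in> X" "x \<noteq> \<one>" "c = ?orb x" by blast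
      have "card c dvd Coset.order G" using act.orbit_stabilizer_theorem[OF Xc[OF x(1)]] x(3)
        by (metis dvd_triv_left)
      then obtain k where k: "card c = p ^ k" using ord divides_primepow_nat[OF prime_p] by metis
      have "k \<noteq> 0"
      proof
        assume "k = 0"
        then obtain y where "c = {y}" using k card_1_singletonE by auto
        then have single: "c = {x}" using orb_self[OF Xc[OF x(1)]] x(3) by auto
        have "comm x g = \<one>" if g: "g \<in> carrier G" for g
        proof -
          have "g \<otimes> x \<otimes> inv g \<in> c" using orb[OF Xc[OF x(1)]] x(3) g by blast
          then have "comm g x \<otimes> x = x" using single conj_eq_comm_mult[OF g Xc[OF x(1)]] by simp
          then have "comm g x = \<one>" using g Xc[OF x(1)] by simp
          then show ?thesis using comm_eq_one_sym[OF g Xc[OF x(1)]] by simp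
        qed
        then show False using none that x by blast
      qed
      then show "p dvd card c" using k by (simp add: dvd_power)
    qed
    show "\<forall>c1\<in>?orb ` (X - {\<one>}). \<forall>c2\<in>?orb ` (X - {\<one>}). c1 \<noteq> c2 \<longrightarrow> c1 \<inter> c2 = {}"
    proof (intro ballI impI)
      fix c1 c2 assume "c1 \<in> ?orb ` (X - {\<one>})" "c2 \<in> ?orb ` (X - {\<one>})" "c1 \<noteq> c2"
      moreover have "?orb ` (X - {\<one>}) \<subseteq> orbits G (carrier G) ?\<phi>" using Xc by (auto simp: orbits_def)
      ultimately show "c1 \<inter> c2 = {}" using act.disjoint_union by blast
    qed
  qed
  moreover have "\<Union> (?orb ` (X - {\<one>})) = X - {\<one>}" using sub orb_self Xc by blast
  ultimately have "p dvd card (X - {\<one>})" by simp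
  moreover have "card (X - {\<one>}) = card X - 1" using subgroup.one_closed[OF Xs] by simp
  moreover have "{\<one>} \<subset> X" using subgroup.one_closed[OF Xs] X(2) by blast
  then have "p \<le> card X" using subgroup_index[OF triv_subgroup Xs] by simp
  moreover obtain k where k: "card X = p ^ k" using subgroup_card[OF Xs] by blast
  ultimately have *: "p dvd card X - 1" "p dvd card X" "card X \<ge> 1"
    using prime_gt_1_nat[OF prime_p] by (auto intro: dvd_power Suc_leI simp: gr0_conv_Suc)
      (metis One_nat_def dvd_power gr0I leD power_0)
  then have "p dvd 1" by (metis dvd_diffD1)
  then show False using prime_p by (simp add: prime_nat_iff)
qed

text \<open>Choose \<open>M\<close> maximal among the normal subgroups of \<open>G\<close> properly contained in \<open>X\<close>. A nontrivial
  central element of \<open>G/M\<close> inside \<open>X/M\<close> generates a normal subgroup, which is all of \<open>X/M\<close> by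
  maximality.\<close>
lemma normal_central_section:
  assumes X: "X \<lhd> G" "X \<noteq> {\<one>}"
  obtains M where "M \<lhd> G" "M \<subset> X" "\<And>x g. \<lbrakk>x \<in> X; g \<in> carrier G\<rbrakk> \<Longrightarrow> comm x g \<in> M"
proof -
  have Xs: "subgroup X G" using normal_imp_subgroup[OF X(1)] .
  define P where "P M \<longleftrightarrow> M \<lhd> G \<and> M \<subset> X" for M
  have "P {\<one>}" using X subgroup.one_closed[OF Xs] one_is_normal by (auto simp: P_def)
  moreover have "\<forall>M. P M \<longrightarrow> card M < Suc (card X)"
    using card_mono[OF finite_subgroup[OF Xs]] by (auto simp: P_def less_Suc_eq_le)
  ultimately obtain M where PM: "P M" and max: "\<And>K. P K \<Longrightarrow> card K \<le> card M"
    using ex_has_greatest_nat[of P "{\<one>}" card "Suc (card X)"] by (metis less_imp_le_nat)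
  have M: "M \<lhd> G" "M \<subset> X" using PM by (auto simp: P_def)
  have Ms: "subgroup M G" using normal_imp_subgroup[OF M(1)] .
  interpret Q: p_group "G Mod M" p by (rule p_group_mod[OF M(1)])
  interpret h: group_hom G "G Mod M" "\<lambda>x. M #> x" by (rule hom_mod[OF M(1)])
  let ?Y = "(\<lambda>x. M #> x) ` X"
  have in_M: "M #> x = \<one>\<^bsub>G Mod M\<^esub> \<longleftrightarrow> x \<in> M" if "x \<in> carrier G" for x
    using that coset_join1[OF _ _ Ms, of x] coset_join2[OF _ Ms, of x] subgroup.subset[OF Ms] by auto
  have Xc: "x \<in> carrier G" if "x \<in> X" for x using subgroup.mem_carrier[OF Xs that] .
  have Y: "?Y \<lhd> G Mod M"
  proof (rule Q.normal_if_comm_closed)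
    show "subgroup ?Y (G Mod M)" by (rule h.subgroup_img_is_subgroup[OF Xs])
    fix y V assume "y \<in> ?Y" "V \<in> carrier (G Mod M)"
    then obtain x v where *: "x \<in> X" "y = M #> x" "v \<in> carrier G" "V = M #> v"
      by (auto simp: carrier_FactGroup)
    then have "Q.comm y V = M #> comm x v" using h.hom_comm[of x v] Xc by simp
    then show "Q.comm y V \<in> ?Y" using normal_comm_closed[OF X(1) *(1,3)] by simp
  qed
  have "?Y \<noteq> {\<one>\<^bsub>G Mod M\<^esub>}"
  proof
    assume "?Y = {\<one>\<^bsub>G Mod M\<^esub>}"
    then have "M #> x = \<one>\<^bsub>G Mod M\<^esub>" if "x \<in> X" for x using that by blast
    then have "X \<subseteq> M" using in_M Xc by blast
    then show False using M(2) by blast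
  qed
  then obtain z where z: "z \<in> ?Y" "z \<noteq> \<one>\<^bsub>G Mod M\<^esub>"
    "\<And>V. V \<in> carrier (G Mod M) \<Longrightarrow> Q.comm z V = \<one>\<^bsub>G Mod M\<^esub>"
    using Q.normal_meets_center[OF Y] by metis
  then obtain x where x: "x \<in> X" "z = M #> x" by blast
  have xM: "x \<notin> M" using in_M[OF Xc[OF x(1)]] z(2) x(2) by simp
  have xg: "comm x g \<in> M" if g: "g \<in> carrier G" for g
    using z(3)[OF h.hom_closed[OF g]] h.hom_comm[OF Xc[OF x(1)] g] x(2) in_M[of "comm x g"] g Xc[OF x(1)] by simp
  let ?K = "generate G (insert x M)"
  have K: "subgroup ?K G" "M \<subseteq> ?K" "x \<in> ?K" using generate_insert[OF Ms Xc[OF x(1)]] .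
  have "?K \<subseteq> cent_mod M (carrier G)"
  proof (rule generate_insert_least)
    show "subgroup (cent_mod M (carrier G)) G" by (rule subgroup_cent_mod[OF M(1)]) simp
    show "x \<in> cent_mod M (carrier G)" using xg Xc[OF x(1)] by (simp add: cent_mod_def)
    show "M \<subseteq> cent_mod M (carrier G)"
      using normal_comm_closed[OF M(1)] subgroup.mem_carrier[OF Ms] by (auto simp: cent_mod_def)
  qed
  then have commK: "comm k g \<in> M" if "k \<in> ?K" "g \<in> carrier G" for k g
    using that by (auto simp: cent_mod_def)
  have Kn: "?K \<lhd> G" using commK K(2) by (intro normal_if_comm_closed[OF K(1)]) blast
  have "?K \<subseteq> X" by (rule generate_insert_least[OF Xs x(1)]) (use M(2) in blast)
  moreover have "\<not> ?K \<subset> X"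
  proof
    assume "?K \<subset> X"
    then have "card ?K \<le> card M" using max Kn by (simp add: P_def)
    moreover have "card M < card ?K"
      using K xM finite_subgroup[OF K(1)] by (intro psubset_card_mono) auto
    ultimately show False by simp
  qed
  ultimately have "?K = X" by blast
  then show ?thesis using that[OF M] commK by simp
qed

lemma lower_central_strict:
  assumes "lower_central G i \<noteq> {\<one>}"
  shows "lower_central G (Suc i) \<subset> lower_central G i"
proof -
  obtain M where M: "M \<lhd> G" "M \<subset> lower_central G i"
    "\<And>x g. \<lbrakk>x \<in> lower_central G i; g \<in> carrier G\<rbrakk> \<Longrightarrow> comm x g \<in> M"
    using normal_central_section[OF lower_central_normal assms] by metis
  have "lower_central G (Suc i) \<subseteq> M"
    unfolding lower_central.simps
    by (intro commutator_subgroup_least normal_imp_subgroup[OF M(1)] M(3))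
  then show ?thesis using M(2) by blast
qed

text \<open>The class is defined as a least number, so it has to be shown that the lower central series
  reaches the trivial subgroup at all.\<close>
lemma nilpotent: "\<exists>c. lower_central G c = {\<one>}"
proof (rule ccontr)
  assume "\<not> ?thesis"
  then have strict: "lower_central G (Suc i) \<subset> lower_central G i" for i using lower_central_strict by blast
  have "card (lower_central G i) + i \<le> Coset.order G" for i
  proof (induction i)
    case (Suc i)
    have "card (lower_central G (Suc i)) < card (lower_central G i)"
      using psubset_card_mono[OF finite_subgroup[OF lower_central_subgroup] strict] .
    then show ?case using Suc by linarith
  qed (simp add: Coset.order_def)
  from this[of "Coset.order G"] have "card (lower_central G (Coset.order G)) = 0" by simp
  then show False
    using finite_subgroup[OF lower_central_subgroup, of "Coset.order G"]
      subgroup.one_closed[OF lower_central_subgroup, of "Coset.order G"] by (metis card_eq_0_iff empty_iff)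
qed

lemma lower_central_class: "lower_central G (nilpotency_class G) = {\<one>}"
  unfolding nilpotency_class_def using nilpotent by (rule LeastI_ex)

lemma lower_central_below_class: "i < nilpotency_class G \<Longrightarrow> lower_central G i \<noteq> {\<one>}"
  unfolding nilpotency_class_def by (rule not_less_Least)

lemma card_lower_central_ge:
  "j \<le> nilpotency_class G \<Longrightarrow> p ^ j \<le> card (lower_central G (nilpotency_class G - j))"
proof (induction j)
  case 0
  then show ?case by (simp add: lower_central_class)
next
  case (Suc j)
  let ?i = "nilpotency_class G - Suc j"
  have i: "Suc ?i = nilpotency_class G - j" using Suc.prems by simp
  have "lower_central G (Suc ?i) \<subset> lower_central G ?i"
    by (rule lower_central_strict, rule lower_central_below_class) (use Suc.prems in simp)
  then have "p * card (lower_central G (Suc ?i)) \<le> card (lower_central G ?i)"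
    by (rule subgroup_index[OF lower_central_subgroup lower_central_subgroup])
  moreover have "p ^ j \<le> card (lower_central G (Suc ?i))" using Suc unfolding i by simp
  ultimately show ?case by (simp only: power_Suc) (meson le_trans mult_le_mono2)
qed

text \<open>A maximal subgroup above \<open>N\<close> and properly below \<open>X\<close>; it is normal because it contains \<open>[X,G]\<close>, and
  the last power \<open>y^(p^s)\<close> of an element \<open>y\<close> that lies outside it generates \<open>X\<close> over it.\<close>
lemma exists_index_p_between:
  assumes N: "subgroup N G" and X: "subgroup X G" "N \<subset> X"
    and comm_X: "\<And>x g. \<lbrakk>x \<in> X; g \<in> carrier G\<rbrakk> \<Longrightarrow> comm x g \<in> N"
  obtains M where "M \<lhd> G" "N \<subseteq> M" "M \<subset> X" "card X = p * card M"
proof -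
  define P where "P M \<longleftrightarrow> subgroup M G \<and> N \<subseteq> M \<and> M \<subset> X" for M
  have "P N" using N X by (simp add: P_def)
  moreover have "\<forall>M. P M \<longrightarrow> card M < Suc (card X)"
    using card_mono[OF finite_subgroup[OF X(1)]] by (auto simp: P_def less_Suc_eq_le)
  ultimately obtain M where PM: "P M" and max: "\<And>K. P K \<Longrightarrow> card K \<le> card M"
    using ex_has_greatest_nat[of P N card "Suc (card X)"] by (metis less_imp_le_nat)
  have M: "subgroup M G" "N \<subseteq> M" "M \<subset> X" using PM by (auto simp: P_def)
  have Mn: "M \<lhd> G" by (rule normal_if_comm_closed[OF M(1)]) (use comm_X M(2,3) in blast)
  obtain y where y: "y \<in> X" "y \<notin> M" using M(3) by blast
  have yc: "y \<in> carrier G" using subgroup.mem_carrier[OF X(1) y(1)] .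
  obtain n where n: "Coset.order G = p ^ n" using ord by blast
  define Q where "Q r \<longleftrightarrow> y [^] (p ^ r) \<in> M" for r :: nat
  have "Q n" unfolding Q_def n[symmetric] pow_order_eq_1[OF yc] using subgroup.one_closed[OF M(1)] .
  define r where "r = (LEAST r. Q r)"
  have Qr: "Q r" unfolding r_def using \<open>Q n\<close> by (rule LeastI)
  have "\<not> Q 0" using y yc by (simp add: Q_def)
  then have "r \<noteq> 0" using Qr by metis
  then obtain s where s: "r = Suc s" by (cases r) auto
  have nQ: "\<not> Q s" using not_less_Least[of s Q] s r_def by simp
  define x where "x = y [^] (p ^ s)"
  have x: "x \<in> X" "x \<notin> M" using subgroup_pow_closed[OF X(1) y(1)] nQ by (simp_all add: x_def Q_def)
  have xc: "x \<in> carrier G" using subgroup.mem_carrier[OF X(1) x(1)] .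
  have xp: "x [^] p \<in> M" using Qr yc by (simp add: Q_def x_def s nat_pow_pow mult.commute)
  let ?K = "generate G (insert x M)"
  have K: "subgroup ?K G" "M \<subseteq> ?K" "x \<in> ?K" using generate_insert[OF M(1) xc] .
  have "?K \<subseteq> X" by (rule generate_insert_least[OF X(1) x(1)]) (use M(3) in blast)
  moreover have "\<not> ?K \<subset> X"
  proof
    assume "?K \<subset> X"
    then have "card ?K \<le> card M" using max K(1,2) M(2) by (simp add: P_def)
    moreover have "card M < card ?K"
      using K x(2) finite_subgroup[OF K(1)] by (intro psubset_card_mono) auto
    ultimately show False by simp
  qed
  ultimately have "?K = X" by blast
  then have "card X = p * card M"
    using card_generate_le[OF Mn xc xp] card_generate_ge[OF M(1) xc x(2)] by simp
  then show ?thesis using that Mn M by blast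
qed

end

section \<open>Reduction to class three\<close>

context p_group
begin

text \<open>The quotient by a normal subgroup \<open>N\<close> of index \<open>p\<close> in \<open>\<gamma>\<^sub>3\<close> that contains \<open>\<gamma>\<^sub>4\<close> is of the kind
  studied above. The numbering of \<open>lower_central\<close> starts at zero, so these are the terms 2 and 3.\<close>
lemma cod_if_lower_central_index_le:
  assumes cls: "nilpotency_class G \<ge> 3"
    and index: "Coset.order G \<le> p ^ 6 * card (lower_central G 3)"
  shows "of_nat (p ^ 2) \<in> cod G"
proof -
  define L where "L = lower_central G"
  have L: "subgroup (L i) G" "L i \<lhd> G" for i
    by (simp_all add: L_def lower_central_subgroup lower_central_normal)
  have Lc: "x \<in> carrier G" if "x \<in> L i" for x i using subgroup.mem_carrier[OF L(1) that] .
  have comm_L: "comm x g \<in> L (Suc i)" if "x \<in> L i" "g \<in> carrier G" for x g i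
    using that comm_in_lower_central by (simp add: L_def)
  have L1: "L 1 = derived G (carrier G)" using lower_central_1 by (simp add: L_def)
  have L21: "L 2 \<subseteq> L 1" using lower_central_Suc_subset[of 1] by (simp add: L_def numeral_2_eq_2)
  have "L 3 \<subset> L 2"
    using lower_central_strict[OF lower_central_below_class, of 2] cls
    by (simp add: L_def numeral_3_eq_3 numeral_2_eq_2)
  moreover have comm_L2: "comm x g \<in> L 3" if "x \<in> L 2" "g \<in> carrier G" for x g
    using comm_L[OF that] by (simp add: numeral_3_eq_3 numeral_2_eq_2)
  ultimately obtain N where N: "N \<lhd> G" "L 3 \<subseteq> N" "N \<subset> L 2" "card (L 2) = p * card N"
    using exists_index_p_between[OF L(1) L(1)] by metis
  have Ns: "subgroup N G" using normal_imp_subgroup[OF N(1)] .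
  have card_N: "card N > 0"
    using finite_subgroup[OF Ns] subgroup.one_closed[OF Ns] card_gt_0_iff by blast
  interpret Q: p_group "G Mod N" p by (rule p_group_mod[OF N(1)])
  interpret h: group_hom G "G Mod N" "\<lambda>x. N #> x" by (rule hom_mod[OF N(1)])
  let ?Q = "G Mod N" and ?h = "\<lambda>x. N #> x"
  have one: "?h x = \<one>\<^bsub>?Q\<^esub> \<longleftrightarrow> x \<in> N" if "x \<in> carrier G" for x
    using that coset_join1[OF _ _ Ns, of x] coset_join2[OF _ Ns, of x] subgroup.subset[OF Ns] by auto
  have surj: "?h ` carrier G = carrier ?Q" by (simp add: carrier_FactGroup)
  have derived_Q: "derived ?Q (carrier ?Q) = ?h ` L 1"
    using h.derived_img[of "carrier G"] surj L1 by simp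
  have "of_nat (p ^ 2) \<in> cod ?Q"
  proof (rule ccontr)
    assume contra: "of_nat (p ^ 2) \<notin> cod ?Q"
    have T: "subgroup (?h ` L 2) ?Q" by (rule h.subgroup_img_is_subgroup[OF L(1)])
    have NL: "N \<subseteq> L 2" using N(3) by blast
    have "card (?h ` L 2) * card N = p * card N"
      using card_image_mod[OF Ns L(1) NL] N(4) by (rule trans)
    then have card_T: "card (?h ` L 2) = p" using card_N by (metis mult_right_cancel less_irrefl)
    have TD: "?h ` L 2 \<subseteq> derived ?Q (carrier ?Q)" unfolding derived_Q by (rule image_mono[OF L21])
    have T_central: "Q.comm t g = \<one>\<^bsub>?Q\<^esub>" if tg: "t \<in> ?h ` L 2" "g \<in> carrier ?Q" for t g
    proof -
      obtain x where x: "x \<in> L 2" "t = ?h x" using tg(1) by blast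
      obtain y where y: "y \<in> carrier G" "g = ?h y" using tg(2) unfolding surj[symmetric] by blast
      have "Q.comm t g = ?h (comm x y)" unfolding x(2) y(2) by (rule h.hom_comm[OF Lc[OF x(1)] y(1), symmetric])
      also have "\<dots> = \<one>\<^bsub>?Q\<^esub>"
        unfolding one[OF comm_closed[OF Lc[OF x(1)] y(1)]] using comm_L2[OF x(1) y(1)] N(2) by blast
      finally show ?thesis .
    qed
    have comm_DQ: "Q.comm d g \<in> ?h ` L 2" if tg: "d \<in> derived ?Q (carrier ?Q)" "g \<in> carrier ?Q" for d g
    proof -
      obtain x where x: "x \<in> L 1" "d = ?h x" using tg(1) unfolding derived_Q by blast
      obtain y where y: "y \<in> carrier G" "g = ?h y" using tg(2) unfolding surj[symmetric] by blast
      have "Q.comm d g = ?h (comm x y)" unfolding x(2) y(2) by (rule h.hom_comm[OF Lc[OF x(1)] y(1), symmetric])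
      moreover have "comm x y \<in> L 2" using comm_L[OF x(1) y(1)] by (simp add: numeral_2_eq_2)
      ultimately show ?thesis by blast
    qed
    have noncentral: "\<exists>d\<in>derived ?Q (carrier ?Q). \<exists>g\<in>carrier ?Q. Q.comm d g \<noteq> \<one>\<^bsub>?Q\<^esub>"
    proof (rule ccontr)
      assume none: "\<not> ?thesis"
      have "comm x y \<in> N" if xy: "x \<in> L 1" "y \<in> carrier G" for x y
      proof -
        have "?h x \<in> derived ?Q (carrier ?Q)" unfolding derived_Q using xy(1) by blast
        then have "Q.comm (?h x) (?h y) = \<one>\<^bsub>?Q\<^esub>" using none h.hom_closed[OF xy(2)] by blast
        then have "?h (comm x y) = \<one>\<^bsub>?Q\<^esub>" unfolding h.hom_comm[OF Lc[OF xy(1)] xy(2)] .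
        then show ?thesis unfolding one[OF comm_closed[OF Lc[OF xy(1)] xy(2)]] .
      qed
      then have "commutator_subgroup G (L 1) (carrier G) \<subseteq> N" by (intro commutator_subgroup_least[OF Ns])
      then have "L 2 \<subseteq> N" by (simp add: L_def numeral_2_eq_2)
      then show False using N(3) by blast
    qed
    have pow: "y [^]\<^bsub>?Q\<^esub> p \<in> derived ?Q (carrier ?Q)" if "y \<in> carrier ?Q" for y
      using Q.prime_square_in_cod_if_derived_quotient_not_elementary[OF that] contra by blast
    have "Coset.order ?Q * card N = Coset.order G"
      using lagrange[OF Ns] by (simp add: Coset.order_def FactGroup_def)
    also have "\<dots> \<le> p ^ 6 * card N"
      using index card_mono[OF finite_subgroup[OF Ns] N(2)] unfolding L_def by (meson le_trans mult_le_mono2)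
    finally have order_Q: "Coset.order ?Q \<le> p ^ 6" using card_N by (rule mult_right_le_imp_le)
    have "class3_p_group ?Q p (derived ?Q (carrier ?Q)) (?h ` L 2)"
      by (rule class3_p_group.intro[OF Q.p_group_axioms class3_p_group_axioms.intro[OF refl T card_T TD
            T_central comm_DQ noncentral pow order_Q]])
    then show False using class3_p_group.class3_prime_square_in_cod contra by blast
  qed
  then show ?thesis using cod_mod[OF N(1)] by blast
qed

text \<open>From \<open>|G| = p^(c+k)\<close> and \<open>|\<gamma>\<^sub>4| \<ge> p^(c-3)\<close> the index of \<open>\<gamma>\<^sub>4\<close> is at most \<open>p^(k+3)\<close>. The bound on
  \<open>|G|\<close> guarantees \<open>c \<ge> 3\<close>.\<close>
lemma cod_if_coclass_le_3:
  assumes k: "k \<le> 3" and coclass: "coclass p G = real k" and order: "Coset.order G \<ge> p ^ (k + 3)"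
  shows "of_nat (p ^ 2) \<in> cod G"
proof -
  obtain n where n: "Coset.order G = p ^ n" using ord by blast
  have p: "1 < p" using prime_p prime_gt_1_nat by blast
  let ?c = "nilpotency_class G"
  have "log (real p) (real (Coset.order G)) = real n" using n p by simp
  then have nc: "n = ?c + k" using coclass by (simp add: coclass_def)
  have "k + 3 \<le> n" using order n p power_le_imp_le_exp by metis
  then have c: "?c \<ge> 3" using nc by simp
  have "p ^ n = p ^ (k + 3) * p ^ (?c - 3)" using nc c by (simp add: add.commute flip: power_add)
  also have "\<dots> \<le> p ^ 6 * card (lower_central G 3)"
  proof (rule mult_le_mono)
    show "p ^ (k + 3) \<le> p ^ 6" using k p by (intro power_increasing) auto
    show "p ^ (?c - 3) \<le> card (lower_central G 3)" using card_lower_central_ge[of "?c - 3"] c by simp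
  qed
  finally show ?thesis using cod_if_lower_central_index_le[OF c] n by simp
qed

end

theorem theorem1p1:
  fixes p :: nat and G :: "('a, 'b) monoid_scheme"
  assumes "prime p" and "finite_p_group p G"
  shows "(coclass p G = 2 \<and> Coset.order G \<ge> p ^ 5 \<longrightarrow> of_nat (p ^ 2) \<in> cod G) \<and>
         (coclass p G = 3 \<and> Coset.order G \<ge> p ^ 6 \<longrightarrow> of_nat (p ^ 2) \<in> cod G)"
proof -
  interpret p_group G p
    using assms by (auto simp: finite_p_group_def intro!: p_group.intro p_group_axioms.intro)
  show ?thesis using cod_if_coclass_le_3[of 2] cod_if_coclass_le_3[of 3] by simp
qed

end
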